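(* Let $N\in\mathbb N$ and let $t\in\{0,\dots,N\}$. For any non-constant polynomials $v_1,\dots,v_N\in\mathbb Z[x]$ such that $v_1(x)-v_1(0),\dots,v_N(x)-v_N(0)$ are $\mathbb Q$-linearly independent, there exist a strictly increasing sequence $(n_k)_{k\in\mathbb N}$ in $\mathbb N$ and a $T\in\mathrm{Aut}([0,1],\mathcal B,\mu)$ with the property that for any $A,B\in\mathcal B$ and any $j\in\{1,\dots,N\}$, $$\lim_{k\to\infty}\mu(A\cap T^{-v_j(n_k)}B)=\begin{cases}\mu(A\cap B)&\text{if }j\le t,\\ \mu(A)\mu(B)&\text{if }j>t.\end{cases}$$
   Context: $\mathbb N=\{1,2,\dots\}$. $\mathcal B$ is the Borel $\sigma$-algebra of $[0,1]$ and $\mu$ is Lebesgue measure. $\mathrm{Aut}([0,1],\mathcal B,\mu)$ is the set of invertible $\mu$-preserving transformations $T:[0,1]\to[0,1]$ (as usual identified when they agree $\mu$-a.e.). *)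

theory Defs
  imports "HOL-Analysis.Analysis" "HOL-Computational_Algebra.Polynomial"
begin

abbreviation unit_lborel :: "real measure" where
  "unit_lborel \<equiv> restrict_space lborel {0..1}"

text \<open>
  The automorphisms of a measure space, given by honest (everywhere defined) bimeasurable
  bijections of the underlying space.  Values outside the space are irrelevant.
\<close>

definition Aut :: "'a measure \<Rightarrow> ('a \<Rightarrow> 'a) set" where
  "Aut M = {T. bij_betw T (space M) (space M) \<and>
               T \<in> measurable M M \<and>
               inv_into (space M) T \<in> measurable M M \<and>
               distr M M T = M}"

definition int_iterate :: "'a set \<Rightarrow> ('a \<Rightarrow> 'a) \<Rightarrow> int \<Rightarrow> 'a \<Rightarrow> 'a" where
  "int_iterate S T m = (if m \<ge> 0 then T ^^ nat m else inv_into S T ^^ nat (- m))"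

text \<open>Linear independence over the rationals of a family (not a set) of integer polynomials.\<close>

definition rat_lin_indep :: "nat set \<Rightarrow> (nat \<Rightarrow> int poly) \<Rightarrow> bool" where
  "rat_lin_indep I p \<longleftrightarrow>
     (\<forall>c :: nat \<Rightarrow> rat. (\<Sum>j\<in>I. smult (c j) (map_poly of_int (p j))) = 0 \<longrightarrow> (\<forall>j\<in>I. c j = 0))"

end

theory Submission
  imports Defs "HOL-Probability.Levy" "HOL-Number_Theory.Cong"
begin

text \<open>
  The automorphism is built by cutting the interval into finer and finer cells and permuting them
  cyclically.

  The idea is best seen on rotations. Take a family of rotations of the circle by angles
  \<open>\<alpha> s\<close>, all close to \<open>1 / D\<close>, where \<open>s\<close> is an additional coordinate that runs through
  \<open>{0..<D}\<close>. The map \<open>(x, s) \<mapsto> (x + \<alpha> s, s)\<close> nearly permutes the \<open>D\<close> arcs of length \<open>1 / D\<close>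
  cyclically. After \<open>v j n\<close> steps it has moved \<open>x\<close> by \<open>v j n * \<alpha> s\<close>. If this is close to an
  integer for all \<open>s\<close>, the arcs have returned. If it is close to \<open>(s + const) / D\<close>, then
  averaging over \<open>s\<close> spreads every arc evenly over all arcs: an arc \<open>A\<close> meets the preimage of an arc
  \<open>B\<close> in a set that has nearly the product of their measures. Both behaviours can be prescribed simultaneously, the first for
  \<open>j \<le> t\<close> and the second for \<open>j > t\<close>. Write \<open>\<alpha> s\<close> as \<open>1 / D\<close> plus an expansion in powers of \<open>1 / n\<close>;
  modulo 1 and up to \<open>O(1 / n)\<close>, multiplication by \<open>v j n\<close> is a linear form in the digits whose
  coefficients are those of \<open>v j\<close> (\<open>congruence_of_speed\<close>), and the rational independence of the
  polynomials without their constant terms provides digits with the desired values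
  (\<open>integer_dual_vectors\<close>).

  The coordinate \<open>s\<close> is not moved, so this map is far from ergodic, but only finitely many cells, which do
  not depend on \<open>s\<close>, matter at one stage. The remedy is to replace the map by a single long
  cycle that follows, one after the other, long orbit segments with all possible starting points and all
  values of \<open>s\<close> (\<open>label_word_exists\<close>). Such a cycle is a cyclic permutation of finer cells, which
  nearly induces the given cyclic permutation of the coarser cells (\<open>cutting_step\<close>), and the step can be
  repeated with the finer cells in the role of the arcs.

  The permutations obtained in this way converge almost everywhere, as do their inverses, by the
  Borel-Cantelli lemma; the limit preserves the measure because its characteristic function is a limit of
  those of the cell permutations (\<open>distr_limit_borel\<close>), and it is changed on a null set into a bijection
  (\<open>automorphism_of_AE_inverse\<close>). The error at each stage is chosen after the times of the earlier stages, so
  the behaviour at these times survives in the limit (\<open>cells_near_target\<close>). Finally the convergence is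
  extended from unions of cells to all Borel sets (\<open>tendsto_target\<close>).
\<close>

section \<open>Linear algebra: prescribing the values of a rotation at polynomial times\<close>

text \<open>
Finitely many linearly independent functionals admit dual vectors. When a functional \<open>f l\<close> is
added to a family that already has a dual system \<open>w\<close>, independence says that
\<open>f l - (\<Sum>k. a k * f k)\<close>, with \<open>a k\<close> the value of \<open>f l\<close> at \<open>w k\<close>, does not vanish at some
coordinate \<open>m0\<close>; subtracting from the \<open>m0\<close>-th unit vector its components along the \<open>w k\<close> gives
a vector that only \<open>f l\<close> detects, and the old dual vectors are corrected by multiples of it.
\<close>

lemma dual_vectors:
  fixes f :: "'j \<Rightarrow> 'm \<Rightarrow> rat"
  assumes "finite I" "finite M"
    and "\<And>c. (\<forall>m\<in>M. (\<Sum>j\<in>I. c j * f j m) = 0) \<Longrightarrow> \<forall>j\<in>I. c j = 0"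
  shows "\<exists>w. \<forall>j\<in>I. \<forall>k\<in>I. (\<Sum>m\<in>M. f j m * w k m) = of_bool (j = k)"
  using assms(1,3)
proof (induction I rule: finite_induct)
  case empty
  then show ?case by simp
next
  case (insert l I)
  have "\<forall>j\<in>I. c j = 0" if "\<forall>m\<in>M. (\<Sum>j\<in>I. c j * f j m) = 0" for c
  proof -
    have eq: "(\<Sum>j\<in>I. (if j = l then 0 else c j) * f j m) = (\<Sum>j\<in>I. c j * f j m)" for m
      using insert.hyps by (intro sum.cong) auto
    have "\<forall>j\<in>insert l I. (if j = l then 0 else c j) = 0"
      using that insert.hyps eq by (intro insert.prems) simp
    then show ?thesis using insert.hyps by (metis insertI2)
  qed
  from insert.IH[OF this]
  obtain w where w: "\<And>j k. j \<in> I \<Longrightarrow> k \<in> I \<Longrightarrow> (\<Sum>m\<in>M. f j m * w k m) = of_bool (j = k)"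
    by blast
  define pair where "pair = (\<lambda>j x. \<Sum>m\<in>M. f j m * x m)"
  define a where "a = (\<lambda>k. pair l (w k))"
  have "\<exists>m\<in>M. f l m - (\<Sum>k\<in>I. a k * f k m) \<noteq> 0"
  proof (rule ccontr)
    assume "\<not> ?thesis"
    moreover have eq: "(\<Sum>j\<in>I. (if j = l then 1 else - a j) * f j m) = - (\<Sum>k\<in>I. a k * f k m)" for m
      unfolding sum_negf[symmetric] using insert.hyps by (intro sum.cong) auto
    ultimately have "\<forall>j\<in>insert l I. (if j = l then 1 else - a j) = 0"
      using insert.hyps by (intro insert.prems) simp
    then show False by auto
  qed
  then obtain m0 where m0: "m0 \<in> M" and g: "f l m0 - (\<Sum>k\<in>I. a k * f k m0) \<noteq> 0" by blast
  \<comment> \<open>The vector \<open>y\<close> is dual to \<open>f l\<close>; the value of \<open>f l\<close> before normalisation is \<open>g\<close>.\<close>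
  define g where "g = f l m0 - (\<Sum>k\<in>I. a k * f k m0)"
  define y where "y = (\<lambda>m. (of_bool (m = m0) - (\<Sum>k\<in>I. f k m0 * w k m)) / g)"
  have pair_y: "pair j y = (f j m0 - (\<Sum>k\<in>I. f k m0 * pair j (w k))) / g" for j
  proof -
    have "pair j y = (\<Sum>m\<in>M. (f j m * of_bool (m = m0) - (\<Sum>k\<in>I. f k m0 * (f j m * w k m))) / g)"
      unfolding pair_def y_def
      by (intro sum.cong refl) (simp add: algebra_simps sum_distrib_left diff_divide_distrib)
    also have "\<dots> = ((\<Sum>m\<in>M. f j m * of_bool (m = m0)) - (\<Sum>k\<in>I. f k m0 * pair j (w k))) / g"
      unfolding pair_def sum_divide_distrib[symmetric] sum_subtractf sum_distrib_left
      by (subst sum.swap) simp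
    also have "(\<Sum>m\<in>M. f j m * of_bool (m = m0)) = f j m0"
      using m0 assms(2) by (simp add: of_bool_def if_distrib sum.delta cong: if_cong)
    finally show ?thesis .
  qed
  have y_I: "pair j y = 0" if "j \<in> I" for j
  proof -
    have "(\<Sum>k\<in>I. f k m0 * pair j (w k)) = (\<Sum>k\<in>I. if k = j then f k m0 else 0)"
      unfolding pair_def using that by (intro sum.cong refl) (auto simp: w)
    then show ?thesis using that insert.hyps by (simp add: pair_y sum.delta)
  qed
  have y_l: "pair l y = 1"
    using g by (simp add: pair_y a_def g_def mult.commute)
  define w' where "w' = (\<lambda>k m. if k = l then y m else w k m - a k * y m)"
  have "pair j (w' k) = of_bool (j = k)" if "j \<in> insert l I" "k \<in> insert l I" for j k
  proof (cases "k = l")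
    case True
    then have "w' k = y" by (simp add: w'_def fun_eq_iff)
    then show ?thesis using that True y_I y_l insert.hyps by (cases "j = l") auto
  next
    case False
    then have "w' k = (\<lambda>m. w k m - a k * y m)" by (simp add: w'_def fun_eq_iff)
    then have "pair j (w' k) = pair j (w k) - a k * pair j y"
      unfolding pair_def by (simp add: algebra_simps sum_subtractf sum_distrib_left)
    then show ?thesis
      using that False y_I y_l w insert.hyps by (cases "j = l") (auto simp: a_def pair_def)
  qed
  then show ?case unfolding pair_def by blast
qed

lemma common_denominator:
  fixes S :: "rat set"
  assumes "finite S"
  shows "\<exists>Q::int. Q > 0 \<and> (\<forall>x\<in>S. of_int Q * x \<in> \<int>)"
  using assms
proof (induction rule: finite_induct)
  case empty
  then show ?case by (intro exI[of _ 1]) simp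
next
  case (insert x S)
  then obtain Q where Q: "Q > 0" "\<forall>x\<in>S. of_int Q * x \<in> \<int>" by auto
  obtain a b where ab: "quotient_of x = (a, b)" by force
  then have b: "b > 0" and x: "x = of_int a / of_int b"
    by (simp_all add: quotient_of_denom_pos quotient_of_div)
  have "of_int (Q * b) * y \<in> \<int>" if "y \<in> insert x S" for y
  proof (cases "y = x")
    case True
    then have "of_int (Q * b) * y = of_int (Q * a)" using b x by simp
    then show ?thesis by (metis Ints_of_int)
  next
    case False
    then have "of_int b * (of_int Q * y) \<in> \<int>" using that False Q(2) by (intro Ints_mult[OF Ints_of_int, of "of_int Q * y"]) auto
    then show ?thesis by (simp add: ac_simps)
  qed
  then show ?case using Q b by (intro exI[of _ "Q * b"]) auto
qed

text \<open>
Linear independence enters the construction here. It concerns the polynomials without constant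
terms, so the functionals are the coefficient rows at the exponents \<open>1..d\<close>; clearing denominators costs
the common factor \<open>Q\<close>.
\<close>

lemma integer_dual_vectors:
  fixes v :: "nat \<Rightarrow> int poly"
  assumes "rat_lin_indep {1..N} (\<lambda>j. v j - [:poly (v j) 0:])"
    and deg: "\<And>j. j \<in> {1..N} \<Longrightarrow> degree (v j) \<le> d"
  shows "\<exists>Q w. (Q::int) > 0 \<and> (\<forall>j\<in>{1..N}. \<forall>k\<in>{1..N}.
           (\<Sum>m\<in>{1..d}. coeff (v j) m * w k m) = Q * of_bool (j = k))"
proof -
  define f :: "nat \<Rightarrow> nat \<Rightarrow> rat" where "f = (\<lambda>j m. of_int (coeff (v j) m))"
  have "\<forall>j\<in>{1..N}. c j = 0" if c: "\<forall>m\<in>{1..d}. (\<Sum>j\<in>{1..N}. c j * f j m) = 0" for c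
  proof -
    have "(\<Sum>j\<in>{1..N}. smult (c j) (map_poly of_int (v j - [:poly (v j) 0:]))) = 0"
    proof (rule poly_eqI)
      fix m
      have "coeff (v j - [:poly (v j) 0:]) m = (if m = 0 then 0 else coeff (v j) m)" for j
        by (auto simp: poly_0_coeff_0 coeff_pCons split: nat.split)
      then have "coeff (\<Sum>j\<in>{1..N}. smult (c j) (map_poly of_int (v j - [:poly (v j) 0:]))) m
          = (\<Sum>j\<in>{1..N}. c j * (if m = 0 then 0 else f j m))"
        by (auto simp: coeff_sum coeff_map_poly f_def intro!: sum.cong)
      also have "\<dots> = 0"
      proof (cases "m \<in> {1..d}")
        case False
        then have "(if m = 0 then 0 else f j m) = 0" if "j \<in> {1..N}" for j
          using deg[OF that] by (auto simp: f_def intro!: coeff_eq_0)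
        then show ?thesis by (intro sum.neutral) auto
      qed (use c in auto)
      finally show "coeff (\<Sum>j\<in>{1..N}. smult (c j) (map_poly of_int (v j - [:poly (v j) 0:]))) m
          = coeff 0 m" by simp
    qed
    then show ?thesis using assms(1) unfolding rat_lin_indep_def by blast
  qed
  then obtain w where w: "\<And>j k. j \<in> {1..N} \<Longrightarrow> k \<in> {1..N} \<Longrightarrow>
      (\<Sum>m\<in>{1..d}. f j m * w k m) = of_bool (j = k)"
    using dual_vectors[of "{1..N}" "{1..d}" f] by force
  obtain Q where Q: "Q > 0" "\<And>k m. k \<in> {1..N} \<Longrightarrow> m \<in> {1..d} \<Longrightarrow> of_int Q * w k m \<in> \<int>"
    using common_denominator[of "(\<lambda>(k, m). w k m) ` ({1..N} \<times> {1..d})"] by auto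
  define z where "z = (\<lambda>k m. \<lfloor>of_int Q * w k m\<rfloor>)"
  have z: "of_int (z k m) = of_int Q * w k m" if "k \<in> {1..N}" "m \<in> {1..d}" for k m
    using Q(2)[OF that] by (auto simp: z_def elim: Ints_cases)
  have "(\<Sum>m\<in>{1..d}. coeff (v j) m * z k m) = Q * of_bool (j = k)"
    if "j \<in> {1..N}" "k \<in> {1..N}" for j k
  proof -
    have "of_int (\<Sum>m\<in>{1..d}. coeff (v j) m * z k m) = (\<Sum>m\<in>{1..d}. of_int Q * (f j m * w k m))"
      using z that by (simp add: f_def ac_simps)
    also have "\<dots> = of_int (Q * of_bool (j = k))"
      using w[OF that] by (simp add: sum_distrib_left[symmetric])
    finally show ?thesis by (simp only: of_int_eq_iff)
  qed
  then show ?thesis using Q(1) by blast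
qed

section \<open>Sums over blocks and cyclic shifts of integers\<close>

lemma sum_int_blocks:
  fixes f :: "int \<Rightarrow> 'a :: comm_monoid_add"
  assumes "W > 0"
  shows "(\<Sum>c\<in>{0..<m * W}. f c) = (\<Sum>y\<in>{0..<m}. \<Sum>k\<in>{0..<W}. f (y * W + k))"
proof -
  have a: "y * W + k < m * W" if "y < m" "k < W" for y k
  proof -
    have "y * W + k < (y + 1) * W" using that by (simp add: algebra_simps)
    also have "\<dots> \<le> m * W" using that assms by (intro mult_right_mono) auto
    finally show ?thesis .
  qed
  have b: "c div W < m" if "c < m * W" for c
    using that assms by (smt (verit) div_mult_mod_eq mult_right_mono pos_mod_sign)
  show ?thesis
    unfolding sum.cartesian_product
    by (intro sum.reindex_bij_witness[where i = "\<lambda>(y, k). y * W + k" and j = "\<lambda>c. (c div W, c mod W)"])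
       (use assms a b in \<open>auto simp: pos_imp_zdiv_nonneg_iff\<close>)
qed

lemma sum_cyclic_shift:
  fixes f :: "int \<Rightarrow> 'a :: comm_monoid_add"
  assumes "P > 0"
  shows "(\<Sum>x\<in>{0..<P}. f ((x + y) mod P)) = (\<Sum>x\<in>{0..<P}. f x)"
  by (intro sum.reindex_bij_witness[where i = "\<lambda>x. (x - y) mod P" and j = "\<lambda>x. (x + y) mod P"])
     (use assms in \<open>auto simp: mod_simps\<close>)

section \<open>Angles whose polynomial multiples are prescribed\<close>

text \<open>
In base \<open>n\<close>, multiplication by \<open>n ^ i\<close> shifts digits. The fraction \<open>p / (D * R * n ^ d)\<close> with
\<open>p = R * n ^ d + D * (\<Sum>m. b m * n ^ (d - m))\<close> is
\<open>1 / D + (\<Sum>m. b m / (R * n ^ m))\<close>. Multiplied by \<open>n ^ i\<close> and taken modulo 1, its digits with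
\<open>m < i\<close> become integers, the digit \<open>m = i\<close> becomes \<open>b i / R\<close>, and those with \<open>m > i\<close> have size
\<open>O(1 / n)\<close>. So the rotation angle after \<open>poly q n\<close> steps is, up to \<open>O(1 / n)\<close>, a linear form in
the freely chosen digits, plus the contribution \<open>coeff q 0 / D\<close> of the constant term.
\<close>

lemma congruence_of_speed:
  fixes q :: "int poly" and b :: "nat \<Rightarrow> int"
  assumes "D > 0" "R > 0" "d \<ge> 1" "degree q \<le> d"
  shows "\<exists>C. \<forall>n>0. D dvd n \<longrightarrow> R dvd n \<longrightarrow>
    (\<exists>e. \<bar>e\<bar> \<le> C * n ^ (d - 1) \<and>
      [(R * n ^ d + D * (\<Sum>m=1..d. b m * n ^ (d - m))) * poly q n
        = coeff q 0 * (R * n ^ d) + D * n ^ d * (\<Sum>m=1..d. coeff q m * b m) + e] (mod D * (R * n ^ d)))"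
proof -
  define B where "B = D * (\<Sum>m=1..d. \<bar>b m\<bar>)"
  define C where "C = (\<Sum>i\<le>d. \<bar>coeff q i\<bar> * B)"
  have B: "B \<ge> 0" using assms by (auto simp: B_def intro!: mult_nonneg_nonneg sum_nonneg)
  have "\<exists>e. \<bar>e\<bar> \<le> C * n ^ (d - 1) \<and>
      [(R * n ^ d + D * (\<Sum>m=1..d. b m * n ^ (d - m))) * poly q n
        = coeff q 0 * (R * n ^ d) + D * n ^ d * (\<Sum>m=1..d. coeff q m * b m) + e] (mod D * (R * n ^ d))"
    if n: "n > 0" "D dvd n" "R dvd n" for n
  proof -
    define p where "p = R * n ^ d + D * (\<Sum>m=1..d. b m * n ^ (d - m))"
    define \<epsilon> where "\<epsilon> = (\<lambda>i::nat. D * (\<Sum>m\<in>{i<..d}. b m * n ^ (d + i - m)))"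
    have eps: "\<bar>\<epsilon> i\<bar> \<le> B * n ^ (d - 1)" for i
    proof -
      have "\<bar>\<epsilon> i\<bar> \<le> D * (\<Sum>m\<in>{i<..d}. \<bar>b m * n ^ (d + i - m)\<bar>)"
        unfolding \<epsilon>_def using assms sum_abs[of "\<lambda>m. b m * n ^ (d + i - m)" "{i<..d}"]
        by (simp add: abs_mult[of D])
      also have "\<dots> \<le> D * (\<Sum>m\<in>{i<..d}. \<bar>b m\<bar> * n ^ (d - 1))"
        using assms n
        by (intro mult_left_mono sum_mono) (auto simp: abs_mult intro!: mult_left_mono power_increasing)
      also have "\<dots> \<le> D * (\<Sum>m\<in>{1..d}. \<bar>b m\<bar> * n ^ (d - 1))"
        using assms n by (intro mult_left_mono sum_mono2) auto
      finally show ?thesis by (simp add: B_def sum_distrib_right mult.assoc)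
    qed
    have mono: "[p * n ^ i = of_bool (i = 0) * (R * n ^ d) + D * n ^ d * (of_bool (i \<ge> 1) * b i) + \<epsilon> i]
        (mod D * (R * n ^ d))" if i: "i \<le> d" for i
    proof -
      have "[R * n ^ d * n ^ i = of_bool (i = 0) * (R * n ^ d)] (mod D * (R * n ^ d))"
      proof (cases "i = 0")
        case False
        then have "D dvd n ^ i" using n(2) by (meson dvd_power dvd_trans gr0I)
        then have "D * (R * n ^ d) dvd n ^ i * (R * n ^ d)" by (intro mult_dvd_mono) auto
        then show ?thesis using False by (simp add: cong_0_iff ac_simps)
      qed simp
      moreover have "[D * (\<Sum>m=1..d. b m * n ^ (d - m)) * n ^ i
          = D * n ^ d * (of_bool (i \<ge> 1) * b i) + \<epsilon> i] (mod D * (R * n ^ d))"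
      proof -
        have "D * (\<Sum>m=1..d. b m * n ^ (d - m)) * n ^ i = D * (\<Sum>m=1..d. b m * n ^ (d + i - m))"
          by (simp add: sum_distrib_right sum_distrib_left algebra_simps flip: power_add)
        also have "\<dots> = D * (\<Sum>m\<in>{1..<i} \<union> ({1..d} \<inter> {i}) \<union> {i<..d}. b m * n ^ (d + i - m))"
          using i by (intro arg_cong[where f = "\<lambda>S. D * sum _ S"]) auto
        also have "\<dots>
           = D * (\<Sum>m\<in>{1..<i}. b m * n ^ (d + i - m)) + D * n ^ d * (of_bool (i \<ge> 1) * b i) + \<epsilon> i"
          using i by (subst sum.union_disjoint sum.union_disjoint; auto simp: \<epsilon>_def algebra_simps)+
        finally have eq: "D * (\<Sum>m=1..d. b m * n ^ (d - m)) * n ^ i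
           = D * (\<Sum>m\<in>{1..<i}. b m * n ^ (d + i - m)) + D * n ^ d * (of_bool (i \<ge> 1) * b i) + \<epsilon> i" .
        have "R * n ^ d dvd b m * n ^ (d + i - m)" if "m \<in> {1..<i}" for m
        proof -
          have "n * n ^ d dvd n ^ (d + i - m)" 
            unfolding power_Suc[symmetric] using that by (intro le_imp_power_dvd) auto
          then show ?thesis using n(3) by (meson dvd_mult dvd_trans dvd_refl mult_dvd_mono)
        qed
        then have "D * (R * n ^ d) dvd D * (\<Sum>m\<in>{1..<i}. b m * n ^ (d + i - m))"
          by (intro mult_dvd_mono[OF dvd_refl] dvd_sum)
        then show ?thesis unfolding eq by (simp add: cong_iff_dvd_diff)
      qed
      ultimately show ?thesis
        unfolding p_def distrib_right by (simp only: add.assoc cong_add)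
    qed
    define e where "e = (\<Sum>i\<le>d. coeff q i * \<epsilon> i)"
    have "p * poly q n = (\<Sum>i\<le>d. coeff q i * (p * n ^ i))"
      using assms(4)
      by (subst poly_as_sum_of_monoms'[symmetric], assumption)
         (auto simp: poly_sum poly_monom sum_distrib_left algebra_simps)
    moreover have "[(\<Sum>i\<le>d. coeff q i * (p * n ^ i)) = (\<Sum>i\<le>d. coeff q i *
        (of_bool (i = 0) * (R * n ^ d) + D * n ^ d * (of_bool (i \<ge> 1) * b i) + \<epsilon> i))] (mod D * (R * n ^ d))"
      using mono by (intro cong_sum cong_mult) auto
    moreover have "(\<Sum>i\<le>d. coeff q i *
        (of_bool (i = 0) * (R * n ^ d) + D * n ^ d * (of_bool (i \<ge> 1) * b i) + \<epsilon> i))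
        = coeff q 0 * (R * n ^ d) + D * n ^ d * (\<Sum>m=1..d. coeff q m * b m) + e"
    proof -
      have 1: "(\<Sum>i\<le>d. coeff q i * (of_bool (i = 0) * (R * n ^ d))) = coeff q 0 * (R * n ^ d)"
        by (subst sum.remove[of _ 0]) (auto intro!: sum.neutral)
      have 2: "(\<Sum>i\<le>d. coeff q i * (D * n ^ d * (of_bool (i \<ge> 1) * b i))) = D * n ^ d * (\<Sum>m=1..d. coeff q m * b m)"
        unfolding sum_distrib_left by (rule sum.mono_neutral_cong_right) auto
      show ?thesis
        unfolding distrib_left sum.distrib 1 2 e_def ..
    qed
    moreover have "\<bar>e\<bar> \<le> C * n ^ (d - 1)"
    proof -
      have "\<bar>e\<bar> \<le> (\<Sum>i\<le>d. \<bar>coeff q i * \<epsilon> i\<bar>)" unfolding e_def by (rule sum_abs)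
      also have "\<dots> \<le> (\<Sum>i\<le>d. \<bar>coeff q i\<bar> * (B * n ^ (d - 1)))"
        using eps by (intro sum_mono) (auto simp: abs_mult intro!: mult_left_mono)
      finally show ?thesis by (simp add: C_def sum_distrib_right mult.assoc)
    qed
    ultimately show ?thesis unfolding p_def by auto
  qed
  then show ?thesis by blast
qed

section \<open>Words read off from many rotation orbits\<close>

lemma card_filter_eq_sum:
  "finite A \<Longrightarrow> card {x \<in> A. P x} = (\<Sum>x\<in>A. of_bool (P x))"
  by (simp add: of_bool_def sum.If_cases Int_def flip: card_eq_sum)

text \<open>
A position \<open>c = (s * P + x) * W + k\<close> of a word of length \<open>D * P * W\<close> is the \<open>k\<close>-th point of the
orbit segment of length \<open>W\<close> that starts at \<open>x\<close> and follows the rotation of the integers modulo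
\<open>P\<close> by \<open>p s\<close>; the phase is the point reached there. All starting points \<open>x\<close> and all
speeds \<open>s\<close> occur, one segment after the other.
\<close>

definition phase :: "int \<Rightarrow> int \<Rightarrow> (int \<Rightarrow> int) \<Rightarrow> int \<Rightarrow> int" where
  "phase P W p c = (c div W mod P + p (c div W div P) * (c mod W)) mod P"

lemma phase_bounds: "P > 0 \<Longrightarrow> 0 \<le> phase P W p c \<and> phase P W p c < P"
  by (simp add: phase_def)

text \<open>
For fixed \<open>s\<close> and \<open>k\<close> the phase is a translate of the starting point \<open>x\<close>. Hence phases are
exactly equidistributed, whatever the speeds are.
\<close>

lemma card_phase:
  assumes "P > 0" "W > 0"
  shows "card {c \<in> {0..<D * P * W}. Q (c div W div P) (c mod W) (phase P W p c)}
       = (\<Sum>s\<in>{0..<D}. \<Sum>k\<in>{0..<W}. card {u \<in> {0..<P}. Q s k u})"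
proof -
  let ?g = "\<lambda>s k u. of_bool (Q s k u) :: nat"
  have "card {c \<in> {0..<D * P * W}. Q (c div W div P) (c mod W) (phase P W p c)}
      = (\<Sum>c\<in>{0..<D * P * W}. ?g (c div W div P) (c mod W) (phase P W p c))"
    by (rule card_filter_eq_sum) simp
  also have "\<dots> = (\<Sum>s\<in>{0..<D}. \<Sum>x\<in>{0..<P}. \<Sum>k\<in>{0..<W}. ?g s k ((x + p s * k) mod P))"
    using assms unfolding sum_int_blocks[OF assms(2)] sum_int_blocks[OF assms(1)]
    by (intro sum.cong refl) (simp add: phase_def)
  also have "\<dots> = (\<Sum>s\<in>{0..<D}. \<Sum>k\<in>{0..<W}. \<Sum>x\<in>{0..<P}. ?g s k ((x + p s * k) mod P))"
    by (rule sum.cong[OF refl], rule sum.swap)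
  also have "\<dots> = (\<Sum>s\<in>{0..<D}. \<Sum>k\<in>{0..<W}. \<Sum>u\<in>{0..<P}. ?g s k u)"
    by (rule sum.cong[OF refl], rule sum.cong[OF refl], rule sum_cyclic_shift[OF assms(1)])
  finally show ?thesis by (simp only: card_filter_eq_sum finite_atLeastLessThan_int)
qed

lemma card_div_filter:
  assumes "M > 0"
  shows "card {u \<in> {0..<D * M}. R (u div M)} = nat M * card {a \<in> {0..<D}. R a}"
proof -
  have "card {u \<in> {0..<D * M}. R (u div M)} = (\<Sum>a\<in>{0..<D}. \<Sum>k\<in>{0..<M}. of_bool (R a))"
    unfolding card_filter_eq_sum[OF finite_atLeastLessThan_int] sum_int_blocks[OF assms]
    by (intro sum.cong refl) simp
  then show ?thesis
    unfolding card_filter_eq_sum[OF finite_atLeastLessThan_int] by (simp add: sum_distrib_left)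
qed

lemma card_overflow: "int (card {k \<in> {0..<W}. k + w \<notin> {0..<W}}) \<le> \<bar>w\<bar>"
proof -
  have "{k \<in> {0..<W}. k + w \<notin> {0..<W}} \<subseteq> (if w \<ge> 0 then {W - w..<W} else {0..<- w})" by auto
  then have "card {k \<in> {0..<W}. k + w \<notin> {0..<W}} \<le> card (if w \<ge> 0 then {W - w..<W} else {0..<- w})"
    by (intro card_mono) auto
  then show ?thesis by (auto split: if_splits)
qed

text \<open>
An error \<open>e\<close> in the phase changes the arc of length \<open>M\<close> that contains it only within distance
\<open>\<bar>e\<bar>\<close> of one of the \<open>D\<close> end points.
\<close>

lemma card_div_perturb:
  assumes "M > 0" "D \<ge> 0"
  shows "int (card {u \<in> {0..<D * M}. (u + e) div M \<noteq> u div M}) \<le> D * \<bar>e\<bar>"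
proof -
  have iff: "(a * M + k + e) div M \<noteq> (a * M + k) div M \<longleftrightarrow> k + e \<notin> {0..<M}" if "k \<in> {0..<M}" for a k
  proof -
    have "(a * M + k + e) div M = a + (k + e) div M"
      using assms by (metis add.assoc div_mult_self3 less_irrefl)
    moreover have "(a * M + k) div M = a" using that assms by simp
    moreover have "(k + e) div M = 0 \<longleftrightarrow> k + e \<in> {0..<M}"
      using assms by (auto simp: div_eq_0_iff zdiv_eq_0_iff)
    ultimately show ?thesis by auto
  qed
  have "card {u \<in> {0..<D * M}. (u + e) div M \<noteq> u div M}
      = (\<Sum>a\<in>{0..<D}. card {k \<in> {0..<M}. k + e \<notin> {0..<M}})"
    unfolding card_filter_eq_sum[OF finite_atLeastLessThan_int] sum_int_blocks[OF assms(1)]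
    by (intro sum.cong refl) (simp only: iff)
  then have "int (card {u \<in> {0..<D * M}. (u + e) div M \<noteq> u div M})
      = (\<Sum>a\<in>{0..<D}. int (card {k \<in> {0..<M}. k + e \<notin> {0..<M}}))"
    by (simp only: of_nat_sum)
  also have "\<dots> \<le> (\<Sum>a\<in>{0..<D}. \<bar>e\<bar>)" by (intro sum_mono card_overflow)
  finally show ?thesis using assms by simp
qed

lemma mod_mult_div: "M > 0 \<Longrightarrow> D > 0 \<Longrightarrow> (u mod (D * M)) div M = (u div M) mod (D::int)"
  by (subst mult.commute, subst zmod_zmult2_eq) auto

lemma div_in_range: 
  fixes W :: int
  assumes "W > 0" "c \<in> {0..<m * W}" shows "c div W \<in> {0..<m}"
  using assms by (auto simp: pos_imp_zdiv_nonneg_iff) (smt (verit) div_mult_mod_eq mult_right_mono pos_mod_sign)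

lemma block_in_range:
  fixes W :: int
  assumes "y \<in> {0..<m}" "k \<in> {0..<W}" shows "y * W + k \<in> {0..<m * W}"
proof -
  have "(y + 1) * W \<le> m * W" using assms by (intro mult_right_mono) auto
  then show ?thesis using assms by (simp add: algebra_simps)
qed

lemma phase_shift:
  assumes "P > 0" "W > 0" "c \<in> {0..<D * P * W}" "c mod W + w \<in> {0..<W}"
  shows "phase P W p ((c + w) mod (D * P * W)) = (phase P W p c + p (c div W div P) * w) mod P"
proof -
  define y k where "y = c div W" and "k = c mod W + w"
  have c: "c + w = y * W + k" and k: "k \<in> {0..<W}"
    using assms(4) by (simp_all add: y_def k_def flip: add.assoc)
  have "(y * W + k) div W = y" "(y * W + k) mod W = k" using assms(2) k by simp_all
  then have q: "(c + w) div W = c div W" "(c + w) mod W = c mod W + w"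
    unfolding c by (simp_all add: y_def k_def)
  have "y \<in> {0..<D * P}" using assms unfolding y_def by (intro div_in_range) auto
  then have "c + w \<in> {0..<D * P * W}" unfolding c using k by (intro block_in_range)
  then have "(c + w) mod (D * P * W) = c + w" by simp
  then show ?thesis unfolding phase_def by (simp add: q mod_simps algebra_simps)
qed

text \<open>
Moving \<open>w\<close> places along the word adds \<open>p s * w\<close> to the phase, unless the end of the orbit segment
is crossed; the first term bounds these exceptions. If \<open>p s * w\<close> is \<open>h s\<close> whole arcs up to
an error \<open>E\<close>, the label therefore advances by \<open>h s\<close> except where the error carries the phase
across the end of an arc, which gives the second term.
\<close>

lemma card_word_shift:
  fixes h e :: "int \<Rightarrow> int"
  assumes "D > 0" "M > 0" "W > 0"
    and e: "\<And>s. s \<in> {0..<D} \<Longrightarrow> \<bar>e s\<bar> \<le> E \<and> [p s * w = h s * M + e s] (mod D * M)"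
    and L: "L = D * (D * M) * W"
    and lam: "lam = (\<lambda>c. phase (D * M) W p c div M)"
  shows "int (card {c \<in> {0..<L}. lam ((c + w) mod L) \<noteq> (lam c + h (c div W div (D * M))) mod D})
     \<le> D * (D * M) * \<bar>w\<bar> + D * W * (D * E)"
proof -
  define P where "P = D * M"
  have P: "P > 0" using assms by (simp add: P_def)
  have L': "L = D * P * W" using L P_def by simp
  have s_range: "c div W div P \<in> {0..<D}" if "c \<in> {0..<L}" for c
    using that assms P unfolding L'
    by (intro div_in_range) auto
  have good: "lam ((c + w) mod L) = (lam c + h (c div W div P)) mod D"
    if c: "c \<in> {0..<L}" and k: "c mod W + w \<in> {0..<W}"
      and u: "(phase P W p c + e (c div W div P)) div M = phase P W p c div M" for c
  proof -
    define s where "s = c div W div P"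
    have "phase P W p ((c + w) mod L) = (phase P W p c + p s * w) mod P"
      unfolding L' s_def using c k P assms(3) by (intro phase_shift) (auto simp: L')
    also have "\<dots> = (phase P W p c + (h s * M + e s)) mod P"
      using e[OF s_range[OF c]] unfolding s_def[symmetric] P_def[symmetric] cong_def
      by (metis mod_add_right_eq)
    finally have "lam ((c + w) mod L) = ((phase P W p c + e s + h s * M) div M) mod D"
      unfolding lam P_def[symmetric] by (simp add: P_def mod_mult_div assms algebra_simps)
    also have "(phase P W p c + e s + h s * M) div M = (phase P W p c + e s) div M + h s"
      using assms(2) by simp
    finally show ?thesis using u by (simp add: lam P_def s_def)
  qed
  have "card {c \<in> {0..<L}. lam ((c + w) mod L) \<noteq> (lam c + h (c div W div P)) mod D}
     \<le> card {c \<in> {0..<L}. c mod W + w \<notin> {0..<W} \<or>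
        (phase P W p c + e (c div W div P)) div M \<noteq> phase P W p c div M}"
    using good
    by (intro card_mono[OF finite_subset[OF Collect_restrict finite_atLeastLessThan_int]]) auto
  also have "\<dots> = (\<Sum>s\<in>{0..<D}. \<Sum>k\<in>{0..<W}.
      card {u \<in> {0..<P}. k + w \<notin> {0..<W} \<or> (u + e s) div M \<noteq> u div M})"
    unfolding L' by (rule card_phase[OF P assms(3),
        where Q = "\<lambda>s k u. k + w \<notin> {0..<W} \<or> (u + e s) div M \<noteq> u div M"])
  finally have "int (card {c \<in> {0..<L}. lam ((c + w) mod L) \<noteq> (lam c + h (c div W div P)) mod D})
    \<le> (\<Sum>s\<in>{0..<D}. \<Sum>k\<in>{0..<W}.
      int (card {u \<in> {0..<P}. k + w \<notin> {0..<W} \<or> (u + e s) div M \<noteq> u div M}))"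
    unfolding of_nat_sum[symmetric] by (simp only: of_nat_le_iff)
  also have "\<dots> \<le> (\<Sum>s\<in>{0..<D}. \<Sum>k\<in>{0..<W}. of_bool (k + w \<notin> {0..<W}) * P + D * E)"
  proof (intro sum_mono)
    fix s k assume s: "s \<in> {0..<D}"
    have 1: "int (card {u \<in> {0..<P}. (u + e s) div M \<noteq> u div M}) \<le> D * E"
      using card_div_perturb[of M D "e s"] e[OF s] assms(1,2) unfolding P_def
      by (smt (verit) mult_left_mono)
    have 2: "0 \<le> D * E" using e[OF s] assms(1) by (smt (verit) mult_nonneg_nonneg)
    have "card {u \<in> {0..<P}. k + w \<notin> {0..<W} \<or> (u + e s) div M \<noteq> u div M} \<le> card {0..<P}"
      by (rule card_mono[OF finite_atLeastLessThan_int Collect_restrict])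
    then have 3: "int (card {u \<in> {0..<P}. k + w \<notin> {0..<W} \<or> (u + e s) div M \<noteq> u div M}) \<le> P"
      using P by simp
    show "int (card {u \<in> {0..<P}. k + w \<notin> {0..<W} \<or> (u + e s) div M \<noteq> u div M})
        \<le> of_bool (k + w \<notin> {0..<W}) * P + D * E"
    proof (cases "k + w \<in> {0..<W}")
      case True
      then show ?thesis using 1 by (simp only: simp_thms of_bool_eq)
    next
      case False
      then show ?thesis using 2 3 by (simp only: simp_thms of_bool_eq)
    qed
  qed
  also have "\<dots> = D * (int (card {k \<in> {0..<W}. k + w \<notin> {0..<W}}) * P + W * (D * E))"
    unfolding card_filter_eq_sum[OF finite_atLeastLessThan_int]
    using assms by (simp add: sum.distrib sum_distrib_right del: of_bool_not_iff)
  also have "\<dots> \<le> D * (\<bar>w\<bar> * P + W * (D * E))"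
    using assms P card_overflow[of W w] by (intro mult_left_mono add_right_mono mult_right_mono) auto
  finally show ?thesis by (simp add: P_def algebra_simps)
qed

lemma card_word:
  assumes "D > 0" "M > 0" "W > 0" and L: "L = D * (D * M) * W"
    and lam: "lam = (\<lambda>c. phase (D * M) W p c div M)"
  shows "int (card {c \<in> {0..<L}. Q (c div W div (D * M)) (lam c)})
      = W * M * (\<Sum>s\<in>{0..<D}. int (card {a \<in> {0..<D}. Q s a}))"
proof -
  have "card {c \<in> {0..<L}. Q (c div W div (D * M)) (lam c)}
     = (\<Sum>s\<in>{0..<D}. \<Sum>k\<in>{0..<W}. card {u \<in> {0..<D * M}. Q s (u div M)})"
    unfolding L lam using assms by (intro card_phase[where Q = "\<lambda>s k u. Q s (u div M)"]) auto
  then show ?thesis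
    unfolding card_div_filter[OF assms(2)] using assms by (simp add: sum_distrib_left mult.assoc)
qed

section \<open>One refinement step: rigid and mixing times for a cyclic permutation\<close>

text \<open>
Averaging over a shift that runs through all residues decouples the two events exactly. This is
where the product of the two measures comes from.
\<close>

lemma sum_card_shifted_pairs:
  fixes D \<kappa> :: int
  assumes "D > 0" "A \<subseteq> {0..<D}" "B \<subseteq> {0..<D}"
  shows "(\<Sum>s\<in>{0..<D}. card {a \<in> {0..<D}. a \<in> A \<and> (a + (s + \<kappa>)) mod D \<in> B}) = card A * card B"
proof -
  have card: "(\<Sum>a\<in>{0..<D}. of_bool (a \<in> S)) = card S" if "S \<subseteq> {0..<D}" for S
    using that card_filter_eq_sum[of "{0..<D}" "\<lambda>a. a \<in> S"] by (metis Collect_mem_eq Int_absorb1 Int_def finite_atLeastLessThan_int)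
  have "(\<Sum>s\<in>{0..<D}. card {a \<in> {0..<D}. a \<in> A \<and> (a + (s + \<kappa>)) mod D \<in> B})
     = (\<Sum>a\<in>{0..<D}. \<Sum>s\<in>{0..<D}. of_bool (a \<in> A) * of_bool ((s + (a + \<kappa>)) mod D \<in> B))"
    unfolding card_filter_eq_sum[OF finite_atLeastLessThan_int]
    by (subst sum.swap) (simp add: of_bool_conj algebra_simps)
  also have "\<dots> = (\<Sum>a\<in>{0..<D}. of_bool (a \<in> A) * card B)"
    unfolding sum_distrib_left[symmetric]
      sum_cyclic_shift[OF assms(1), where f = "\<lambda>x. of_bool (x \<in> B)"] card[OF assms(3)] ..
  finally show ?thesis by (simp only: sum_distrib_right[symmetric] card[OF assms(2)])
qed

lemma abs_diff_card_le:
  assumes "finite X" "\<And>x. x \<in> X \<Longrightarrow> \<not> R x \<Longrightarrow> P x = Q x"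
  shows "\<bar>real (card {x \<in> X. P x}) - real (card {x \<in> X. Q x})\<bar> \<le> real (card {x \<in> X. R x})"
proof -
  have "card {x \<in> X. P x} \<le> card ({x \<in> X. Q x} \<union> {x \<in> X. R x})"
       "card {x \<in> X. Q x} \<le> card ({x \<in> X. P x} \<union> {x \<in> X. R x})"
    using assms by (auto intro!: card_mono)
  then have "card {x \<in> X. P x} \<le> card {x \<in> X. Q x} + card {x \<in> X. R x}"
       "card {x \<in> X. Q x} \<le> card {x \<in> X. P x} + card {x \<in> X. R x}"
    using card_Un_le order_trans by blast+
  then show ?thesis by linarith
qed

text \<open>
The limit required of the pair (label now, label after \<open>poly (v j) n\<close> steps) when labels are
uniform on \<open>{0..<D}\<close>: labels agree for a rigid exponent and are independent otherwise.
\<close>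

definition pair_density :: "bool \<Rightarrow> int \<Rightarrow> int set \<Rightarrow> int set \<Rightarrow> real" where
  "pair_density rigid D A B =
     (if rigid then card (A \<inter> B) / D else (card A / D) * (card B / D))"

text \<open>
With the dual vectors, digits can be chosen such that for the speed \<open>s\<close> the exponent \<open>v j\<close>
moves the phase by an integer number of turns when \<open>j \<le> t\<close>, and by \<open>s + coeff (v j) 0\<close> arcs when
\<open>j > t\<close>; the digits for \<open>j \<le> t\<close> just cancel the constant term. A single step moves the
phase by nearly one arc, so the word runs cyclically through the labels most of the time. The word
is then almost invariant under the shift by \<open>poly (v j) n\<close> for \<open>j \<le> t\<close>, while for \<open>j > t\<close> averaging
over the \<open>D\<close> speeds makes the shifted label independent of the original one.

First \<open>n\<close> is taken large, which makes the error in the phase small compared with the arcs, and only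
then \<open>W\<close>, which makes the ends of the orbit segments negligible.
\<close>

lemma label_word_exists:
  fixes v :: "nat \<Rightarrow> int poly" and D :: int and \<epsilon> :: real
  assumes indep: "rat_lin_indep {1..N} (\<lambda>j. v j - [:poly (v j) 0:])"
    and D: "D > 0" and eps: "\<epsilon> > 0"
  obtains n :: nat and r :: int and lam :: "int \<Rightarrow> int"
  where "n > K" "r \<ge> 2" "\<forall>c. lam c \<in> {0..<D}"
    "\<forall>a\<in>{0..<D}. int (card {c \<in> {0..<D * r}. lam c = a}) = r"
    "card {c \<in> {0..<D * r}. lam ((c + 1) mod (D * r)) \<noteq> (lam c + 1) mod D} \<le> \<epsilon> * (D * r)"
    "\<forall>j\<in>{1..N}. \<forall>A\<subseteq>{0..<D}. \<forall>B\<subseteq>{0..<D}.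
      \<bar>card {c \<in> {0..<D * r}. lam c \<in> A \<and> lam ((c + poly (v j) (int n)) mod (D * r)) \<in> B}
        - D * r * pair_density (j \<le> t) D A B\<bar> \<le> \<epsilon> * (D * r)"
proof -
  \<comment> \<open>Index 0, which no given polynomial occupies, stands for the exponent 1, so that the single
    step is covered by the same estimates.\<close>
  define V where "V = (\<lambda>j. if j = 0 then 1 else v j)"
  define d where "d = Suc (\<Sum>j\<in>{0..N}. degree (V j))"
  have deg: "degree (V j) \<le> d" if "j \<in> {0..N}" for j
    using member_le_sum[of j "{0..N}" "\<lambda>j. degree (V j)"] that by (simp add: d_def)
  have "degree (v j) \<le> d" if "j \<in> {1..N}" for j
    using deg[of j] that by (simp add: V_def)
  from integer_dual_vectors[OF indep this] obtain Q w where Q: "Q > 0"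
    and w: "\<And>j k. j \<in> {1..N} \<Longrightarrow> k \<in> {1..N} \<Longrightarrow>
           (\<Sum>m\<in>{1..d}. coeff (v j) m * w k m) = Q * of_bool (j = k)"
    by blast
  define R where "R = Q * D"
  have R: "R > 0" using Q D by (simp add: R_def)
  \<comment> \<open>The prescribed movement, in arcs and before adding the constant term of the polynomial.\<close>
  define y where "y = (\<lambda>s k. if k \<le> t then - coeff (v k) 0 else s)"
  define b where "b = (\<lambda>s m. \<Sum>k\<in>{1..N}. y s k * w k m)"
  have coeff_b: "(\<Sum>m=1..d. coeff (v j) m * b s m) = Q * y s j" if "j \<in> {1..N}" for j s
  proof -
    have "(\<Sum>m=1..d. coeff (v j) m * b s m)
        = (\<Sum>k\<in>{1..N}. y s k * (\<Sum>m=1..d. coeff (v j) m * w k m))"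
      unfolding b_def sum_distrib_left by (subst sum.swap) (simp add: ac_simps)
    also have "\<dots> = (\<Sum>k\<in>{1..N}. if k = j then Q * y s k else 0)"
      using w that by (intro sum.cong) auto
    finally show ?thesis using that by simp
  qed
  define h where "h = (\<lambda>j s. if j = 0 then 1 else if j \<le> t then 0 else s + coeff (v j) 0)"
  have h: "coeff (V j) 0 * (R * z) + D * z * (\<Sum>m=1..d. coeff (V j) m * b s m) = h j s * (R * z)"
    if "j \<in> {0..N}" for j s z
  proof (cases "j = 0")
    case True
    then have "(\<Sum>m=1..d. coeff (V j) m * b s m) = 0"
      by (intro sum.neutral) (auto simp: V_def)
    then show ?thesis using True by (simp add: V_def h_def)
  next
    case False
    then show ?thesis using that coeff_b[of j s]
      by (simp add: V_def h_def y_def R_def algebra_simps)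
  qed
  define speed where "speed = (\<lambda>s n. R * n ^ d + D * (\<Sum>m=1..d. b s m * n ^ (d - m)))"
  define good where "good = (\<lambda>s j C. \<forall>n>0. D dvd n \<longrightarrow> R dvd n \<longrightarrow> (\<exists>e. \<bar>e\<bar> \<le> C * n ^ (d - 1) \<and>
      [speed s n * poly (V j) n = h j s * (R * n ^ d) + e] (mod D * (R * n ^ d))))"
  define C where "C = (\<lambda>s j. SOME C. good s j C)"
  have C: "good s j (C s j)" if j: "j \<in> {0..N}" for s j
  proof -
    have "d \<ge> 1" by (simp add: d_def)
    from congruence_of_speed[OF D R this deg[OF j], of "b s"]
    have "\<exists>C. good s j C" unfolding h[OF j] good_def speed_def .
    then show ?thesis unfolding C_def by (rule someI_ex)
  qed
  define C' where "C' = (\<Sum>s\<in>{0..<D}. \<Sum>j\<in>{0..N}. \<bar>C s j\<bar>)"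
  have C': "C s j \<le> C'" if "s \<in> {0..<D}" "j \<in> {0..N}" for s j
  proof -
    have "C s j \<le> (\<Sum>j\<in>{0..N}. \<bar>C s j\<bar>)"
      using member_le_sum[of j "{0..N}" "\<lambda>j. \<bar>C s j\<bar>"] that by auto
    also have "\<dots> \<le> C'" unfolding C'_def
      by (rule member_le_sum[of s "{0..<D}" "\<lambda>s. \<Sum>j\<in>{0..N}. \<bar>C s j\<bar>"]) (use that in \<open>auto intro: sum_nonneg\<close>)
    finally show ?thesis .
  qed
  obtain n' :: nat where n': "real n' \<ge> max (2 * C' / \<epsilon>) (max 2 (K + 1))"
    using real_arch_simple by blast
  \<comment> \<open>The digit shift needs both \<open>D\<close> and \<open>R\<close> to divide \<open>n\<close>.\<close>
  define n where "n = nat (D * R) * n'"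
  have DR: "D * R \<ge> 1" using D R by (simp add: int_one_le_iff_zero_less)
  have "1 * n' \<le> n" unfolding n_def using DR by (intro mult_right_mono) auto
  then have n: "n > K" "n \<ge> 2" "real n \<ge> 2 * C' / \<epsilon>" using n' by linarith+
  have int_n: "int n = D * R * int n'" using DR by (simp add: n_def)
  have dvd: "D dvd int n" "R dvd int n" unfolding int_n by simp_all
  define M where "M = R * int n ^ d"
  have M: "M > 0" using R n by (simp add: M_def)
  define p where "p = (\<lambda>s. M + D * (\<Sum>m=1..d. b s m * int n ^ (d - m)))"
  define E where "E = C' * int n ^ (d - 1)"
  define good_err where "good_err = (\<lambda>j s e. \<bar>e\<bar> \<le> E \<and> [p s * poly (V j) (int n) = h j s * M + e] (mod D * M))"
  define e where "e = (\<lambda>j s. SOME e. good_err j s e)"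
  have e: "\<bar>e j s\<bar> \<le> E \<and> [p s * poly (V j) (int n) = h j s * M + e j s] (mod D * M)"
    if sj: "s \<in> {0..<D}" "j \<in> {0..N}" for s j
  proof -
    have "int n > 0" using n by simp
    then obtain e' where "\<bar>e'\<bar> \<le> C s j * int n ^ (d - 1)"
         "[p s * poly (V j) (int n) = h j s * M + e'] (mod D * M)"
      using C[OF sj(2), of s] dvd unfolding p_def M_def good_def speed_def by blast
    moreover have "C s j * int n ^ (d - 1) \<le> E"
      unfolding E_def using C' sj by (intro mult_right_mono) auto
    ultimately have "good_err j s e'" unfolding good_err_def by linarith
    then have "good_err j s (e j s)" unfolding e_def by (rule someI)
    then show ?thesis unfolding good_err_def .
  qed
  have E: "real_of_int E \<le> \<epsilon> / 2 * M"
  proof -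
    have "2 * C' \<le> \<epsilon> * n" using n(3) eps by (simp add: field_simps)
    moreover have "\<epsilon> * n \<le> \<epsilon> * n * R"
      using mult_left_mono[of 1 "real_of_int R" "\<epsilon> * n"] eps R by simp
    ultimately have "C' \<le> \<epsilon> / 2 * (n * R)" by simp
    then have "C' * real n ^ (d - 1) \<le> \<epsilon> / 2 * (n * R) * real n ^ (d - 1)"
      by (intro mult_right_mono) auto
    also have "\<dots> = \<epsilon> / 2 * M" by (simp add: M_def d_def)
    finally show ?thesis by (simp add: E_def)
  qed
  define W where "W = \<lceil>2 / \<epsilon> * (\<Sum>j\<in>{0..N}. \<bar>poly (V j) (int n)\<bar>)\<rceil> + 1"
  have W_ge: "2 / \<epsilon> * (\<Sum>j\<in>{0..N}. \<bar>poly (V j) (int n)\<bar>) \<le> W" unfolding W_def by linarith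
  have "0 \<le> 2 / \<epsilon> * (\<Sum>j\<in>{0..N}. \<bar>poly (V j) (int n)\<bar>)"
    using eps by (intro mult_nonneg_nonneg) (auto intro: sum_nonneg)
  then have W: "W > 0" unfolding W_def by linarith
  have Wj: "\<bar>poly (V j) (int n)\<bar> \<le> \<epsilon> / 2 * W" if "j \<in> {0..N}" for j
  proof -
    have "\<bar>poly (V j) (int n)\<bar> \<le> (\<Sum>j\<in>{0..N}. \<bar>poly (V j) (int n)\<bar>)"
      by (rule member_le_sum) (use that in auto)
    then have "real_of_int \<bar>poly (V j) (int n)\<bar> \<le> real_of_int (\<Sum>j\<in>{0..N}. \<bar>poly (V j) (int n)\<bar>)"
      by (simp only: of_int_le_iff)
    also have "\<dots> \<le> \<epsilon> / 2 * W" using W_ge eps by (simp add: field_simps)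
    finally show ?thesis .
  qed
  define r where "r = D * M * W"
  define lam where "lam = (\<lambda>c. phase (D * M) W p c div M)"
  have L: "D * r = D * (D * M) * W" by (simp add: r_def)
  have DM: "D * M > 0" using D M by simp
  have bad: "card {c \<in> {0..<D * r}. lam ((c + poly (V j) (int n)) mod (D * r))
        \<noteq> (lam c + h j (c div W div (D * M))) mod D} \<le> \<epsilon> * (D * r)" if j: "j \<in> {0..N}" for j
  proof -
    let ?w = "poly (V j) (int n)"
    have "int (card {c \<in> {0..<D * r}. lam ((c + ?w) mod (D * r))
        \<noteq> (lam c + h j (c div W div (D * M))) mod D}) \<le> D * (D * M) * \<bar>?w\<bar> + D * W * (D * E)"
      using e j by (intro card_word_shift[OF D M W _ L lam_def]) auto
    then have "real (card {c \<in> {0..<D * r}. lam ((c + ?w) mod (D * r))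
        \<noteq> (lam c + h j (c div W div (D * M))) mod D}) \<le> real_of_int (D * (D * M) * \<bar>?w\<bar> + D * W * (D * E))"
      by linarith
    also have "\<dots> = real_of_int (D * (D * M)) * real_of_int \<bar>?w\<bar> + real_of_int (D * W * D) * real_of_int E"
      by (simp add: algebra_simps)
    also have "\<dots> \<le> real_of_int (D * (D * M)) * (\<epsilon> / 2 * W) + real_of_int (D * W * D) * (\<epsilon> / 2 * M)"
      using D M W Wj[OF j] E by (intro add_mono mult_left_mono) auto
    also have "\<dots> = \<epsilon> * (D * r)" by (simp add: r_def algebra_simps)
    finally show ?thesis .
  qed
  have r2: "r \<ge> 2"
  proof -
    have "2 * 1 \<le> int n * int n ^ (d - 1)" using n by (intro mult_mono) auto
    then have "2 \<le> int n ^ d" by (simp add: d_def)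
    then have "1 * (1 * 2) * 1 \<le> D * (R * int n ^ d) * W"
      using D R W by (intro mult_mono) auto
    then show ?thesis by (simp add: r_def M_def)
  qed
  have range: "lam c \<in> {0..<D}" for c
    using phase_bounds[OF DM, of W p c] M unfolding lam_def
    by (intro div_in_range) auto
  have fibre: "int (card {c \<in> {0..<D * r}. lam c = a}) = r" if "a \<in> {0..<D}" for a
  proof -
    have "{a' \<in> {0..<D}. a' = a} = {a}" using that by auto
    then show ?thesis using card_word[OF D M W L lam_def, of "\<lambda>s a'. a' = a"] D
      by (simp add: r_def ac_simps)
  qed
  have succ: "card {c \<in> {0..<D * r}. lam ((c + 1) mod (D * r)) \<noteq> (lam c + 1) mod D} \<le> \<epsilon> * (D * r)"
    using bad[of 0] by (simp add: V_def h_def)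
  have pairs: "\<bar>card {c \<in> {0..<D * r}. lam c \<in> A \<and> lam ((c + poly (v j) (int n)) mod (D * r)) \<in> B}
        - D * r * pair_density (j \<le> t) D A B\<bar> \<le> \<epsilon> * (D * r)"
    if j: "j \<in> {1..N}" and AB: "A \<subseteq> {0..<D}" "B \<subseteq> {0..<D}" for j A B
  proof -
    have jN: "j \<in> {0..N}" and V: "V j = v j" using j by (auto simp: V_def)
    have "int (card {c \<in> {0..<D * r}. lam c \<in> A \<and> (lam c + h j (c div W div (D * M))) mod D \<in> B})
       = W * M * int (\<Sum>s\<in>{0..<D}. card {a \<in> {0..<D}. a \<in> A \<and> (a + h j s) mod D \<in> B})"
      using card_word[OF D M W L lam_def, of "\<lambda>s a. a \<in> A \<and> (a + h j s) mod D \<in> B"] by simp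
    also have "real_of_int \<dots> = D * r * pair_density (j \<le> t) D A B"
    proof (cases "j \<le> t")
      case True
      have "{a \<in> {0..<D}. a \<in> A \<and> (a + h j s) mod D \<in> B} = A \<inter> B" for s
        using True j AB by (auto simp: h_def)
      then show ?thesis using True D by (simp add: pair_density_def r_def)
    next
      case False
      then have "(\<Sum>s\<in>{0..<D}. card {a \<in> {0..<D}. a \<in> A \<and> (a + h j s) mod D \<in> B}) = card A * card B"
        using sum_card_shifted_pairs[OF D AB, of "coeff (v j) 0"] by (simp add: h_def)
      then show ?thesis using False D by (simp add: pair_density_def r_def)
    qed
    finally have main: "real (card {c \<in> {0..<D * r}. lam c \<in> A \<and> (lam c + h j (c div W div (D * M))) mod D \<in> B})
       = D * r * pair_density (j \<le> t) D A B" by simp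
    let ?w = "poly (v j) (int n)"
    have "\<bar>real (card {c \<in> {0..<D * r}. lam c \<in> A \<and> lam ((c + ?w) mod (D * r)) \<in> B})
       - real (card {c \<in> {0..<D * r}. lam c \<in> A \<and> (lam c + h j (c div W div (D * M))) mod D \<in> B})\<bar>
       \<le> real (card {c \<in> {0..<D * r}. lam ((c + ?w) mod (D * r)) \<noteq> (lam c + h j (c div W div (D * M))) mod D})"
      by (rule abs_diff_card_le) auto
    also have "\<dots> \<le> \<epsilon> * (D * r)" using bad[OF jN] unfolding V .
    finally show ?thesis unfolding main .
  qed
  show ?thesis
  proof (rule that[of n r lam, OF n(1) r2 _ _ succ])
    show "\<forall>c. lam c \<in> {0..<D}" using range by blast
    show "\<forall>a\<in>{0..<D}. int (card {c \<in> {0..<D * r}. lam c = a}) = r" using fibre by (intro ballI)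
  qed (intro ballI allI impI, rule pairs)
qed

text \<open>
The \<open>m\<close>-th power of a cyclic permutation of \<open>{0..<D}\<close>, where \<open>pos c\<close> is the element visited at
time \<open>c\<close>.
\<close>

definition cyc :: "int \<Rightarrow> (int \<Rightarrow> int) \<Rightarrow> int \<Rightarrow> int \<Rightarrow> int" where
  "cyc D pos m q = pos ((inv_into {0..<D} pos q + m) mod D)"

lemma cyc_pos:
  assumes "bij_betw pos {0..<D} {0..<D}" "c \<in> {0..<D}"
  shows "cyc D pos m (pos c) = pos ((c + m) mod D)"
  using assms by (simp add: cyc_def bij_betw_inv_into_left)

lemma card_filter_bij:
  assumes "bij_betw f A A"
  shows "card {x \<in> A. P x} = card {x \<in> A. P (f x)}"
proof -
  have "{x \<in> A. P x} = f ` {x \<in> A. P (f x)}"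
    using assms by (auto simp: bij_betw_def)
  moreover have "inj_on f {x \<in> A. P (f x)}"
    using assms by (auto simp: bij_betw_def inj_on_def)
  ultimately show ?thesis by (simp add: card_image)
qed

text \<open>
A labelling with fibres of equal size \<open>r\<close> can be realised geometrically: cut each of \<open>D\<close>
cells into \<open>r\<close> pieces and enumerate the positions with label \<open>a\<close> by the pieces of cell \<open>a\<close>.
\<close>

lemma refine_positions:
  fixes D r :: int
  assumes "r > 0" "\<And>c. c \<in> {0..<D * r} \<Longrightarrow> g c \<in> {0..<D}"
    "\<And>a. a \<in> {0..<D} \<Longrightarrow> int (card {c \<in> {0..<D * r}. g c = a}) = r"
  shows "\<exists>f. bij_betw f {0..<D * r} {0..<D * r} \<and> (\<forall>c\<in>{0..<D * r}. f c div r = g c)"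
proof -
  let ?L = "{0..<D * r}"
  have "\<exists>h. bij_betw h {c \<in> ?L. g c = a} {0..<r}" if "a \<in> {0..<D}" for a
    using assms(1) assms(3)[OF that]
    by (intro finite_same_card_bij finite_subset[OF Collect_restrict]) auto
  moreover define h where "h = (\<lambda>a. SOME h. bij_betw h {c \<in> ?L. g c = a} {0..<r})"
  ultimately have h: "bij_betw (h a) {c \<in> ?L. g c = a} {0..<r}" if "a \<in> {0..<D}" for a
    using that someI_ex[of "\<lambda>h. bij_betw h {c \<in> ?L. g c = a} {0..<r}"] by blast
  define f where "f = (\<lambda>c. g c * r + h (g c) c)"
  have hc: "h (g c) c \<in> {0..<r}" if "c \<in> ?L" for c
    using bij_betwE[OF h[OF assms(2)[OF that]]] that by auto
  have div: "f c div r = g c" and md: "f c mod r = h (g c) c" if "c \<in> ?L" for c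
    using hc[OF that] assms(1) by (simp_all add: f_def)
  have "f ` ?L \<subseteq> ?L"
    unfolding f_def using assms(2) hc by (intro image_subsetI block_in_range) auto
  moreover have "inj_on f ?L"
  proof (rule inj_onI)
    fix c c' assume c: "c \<in> ?L" "c' \<in> ?L" "f c = f c'"
    then have eq: "g c = g c'" "h (g c) c = h (g c') c'" using div md by metis+
    have "inj_on (h (g c)) {c' \<in> ?L. g c' = g c}"
      using h[OF assms(2)[OF c(1)]] by (simp add: bij_betw_def)
    then show "c = c'" using c eq by (auto simp: inj_on_def)
  qed
  ultimately have "bij_betw f ?L ?L" by (simp add: bij_betw_def endo_inj_surj)
  then show ?thesis using div by blast
qed

text \<open>
The word becomes a cyclic permutation of the \<open>D * r\<close> smaller cells: the piece visited at time \<open>c\<close>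
lies in the cell named by the \<open>c\<close>-th label. The number of times at which the label does not
advance by one is the number of pieces on which the new permutation disagrees with the old one.
\<close>

lemma cutting_step:
  fixes v :: "nat \<Rightarrow> int poly" and D :: int and \<epsilon> :: real
  assumes indep: "rat_lin_indep {1..N} (\<lambda>j. v j - [:poly (v j) 0:])"
    and D: "D > 0" and eps: "\<epsilon> > 0" and pos: "bij_betw pos {0..<D} {0..<D}"
  obtains n :: nat and r :: int and pos' :: "int \<Rightarrow> int"
  where "n > K" "r \<ge> 2" "bij_betw pos' {0..<D * r} {0..<D * r}"
    "card {q \<in> {0..<D * r}. cyc (D * r) pos' 1 q div r \<noteq> cyc D pos 1 (q div r)} \<le> \<epsilon> * (D * r)"
    "\<forall>j\<in>{1..N}. \<forall>A\<subseteq>{0..<D}. \<forall>B\<subseteq>{0..<D}.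
      \<bar>card {q \<in> {0..<D * r}. q div r \<in> A \<and> cyc (D * r) pos' (poly (v j) (int n)) q div r \<in> B}
        - D * r * pair_density (j \<le> t) D A B\<bar> \<le> \<epsilon> * (D * r)"
proof -
  obtain n r lam where n: "n > K" and r: "r \<ge> 2" and "\<forall>c. lam c \<in> {0..<D}"
    and "\<forall>a\<in>{0..<D}. int (card {c \<in> {0..<D * r}. lam c = a}) = r"
    and succ: "card {c \<in> {0..<D * r}. lam ((c + 1) mod (D * r)) \<noteq> (lam c + 1) mod D} \<le> \<epsilon> * (D * r)"
    and pairs: "\<forall>j\<in>{1..N}. \<forall>A\<subseteq>{0..<D}. \<forall>B\<subseteq>{0..<D}.
      \<bar>card {c \<in> {0..<D * r}. lam c \<in> A \<and> lam ((c + poly (v j) (int n)) mod (D * r)) \<in> B}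
        - D * r * pair_density (j \<le> t) D A B\<bar> \<le> \<epsilon> * (D * r)"
    by (rule label_word_exists[OF indep D eps, where K = K and t = t])
  then have lam: "lam c \<in> {0..<D}"
    and fib: "a \<in> {0..<D} \<Longrightarrow> int (card {c \<in> {0..<D * r}. lam c = a}) = r" for c a
    by blast+
  have inj: "pos a = pos b \<longleftrightarrow> a = b" if "a \<in> {0..<D}" "b \<in> {0..<D}" for a b
    using pos that by (auto simp: bij_betw_def inj_on_def)
  have fib': "int (card {c \<in> {0..<D * r}. pos (lam c) = a}) = r" if a: "a \<in> {0..<D}" for a
  proof -
    obtain a' where a': "a' \<in> {0..<D}" "a = pos a'"
      using bij_betw_imp_surj_on[OF pos] a by blast
    then show ?thesis using fib[of a'] inj lam by simp
  qed
  obtain pos' where pos': "bij_betw pos' {0..<D * r} {0..<D * r}"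
    and lift: "\<And>c. c \<in> {0..<D * r} \<Longrightarrow> pos' c div r = pos (lam c)"
    using refine_positions[of r D "\<lambda>c. pos (lam c)"] r fib' bij_betwE[OF pos] lam by auto
  have Dr: "D * r > 0" using D r by simp
  have cyc': "cyc (D * r) pos' m (pos' c) div r = pos (lam ((c + m) mod (D * r)))"
    if "c \<in> {0..<D * r}" for c m
    using Dr by (simp add: cyc_pos[OF pos' that] lift)
  have cyc: "cyc D pos 1 (pos (lam c)) = pos ((lam c + 1) mod D)" for c
    using cyc_pos[OF pos lam] .
  have "card {q \<in> {0..<D * r}. cyc (D * r) pos' 1 q div r \<noteq> cyc D pos 1 (q div r)}
      = card {c \<in> {0..<D * r}. cyc (D * r) pos' 1 (pos' c) div r \<noteq> cyc D pos 1 (pos' c div r)}"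
    by (rule card_filter_bij[OF pos'])
  also have "{c \<in> {0..<D * r}. cyc (D * r) pos' 1 (pos' c) div r \<noteq> cyc D pos 1 (pos' c div r)}
      = {c \<in> {0..<D * r}. lam ((c + 1) mod (D * r)) \<noteq> (lam c + 1) mod D}"
  proof (intro Collect_cong conj_cong refl)
    fix c assume c: "c \<in> {0..<D * r}"
    have "(lam c + 1) mod D \<in> {0..<D}" using D by simp
    then show "cyc (D * r) pos' 1 (pos' c) div r \<noteq> cyc D pos 1 (pos' c div r) \<longleftrightarrow>
        lam ((c + 1) mod (D * r)) \<noteq> (lam c + 1) mod D"
      unfolding cyc'[OF c] lift[OF c] cyc using inj lam by simp
  qed
  finally have succ': "card {q \<in> {0..<D * r}. cyc (D * r) pos' 1 q div r \<noteq> cyc D pos 1 (q div r)}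
      \<le> \<epsilon> * (D * r)" using succ by simp
  have pairs': "\<bar>card {q \<in> {0..<D * r}. q div r \<in> A \<and> cyc (D * r) pos' (poly (v j) (int n)) q div r \<in> B}
        - D * r * pair_density (j \<le> t) D A B\<bar> \<le> \<epsilon> * (D * r)"
    if j: "j \<in> {1..N}" and AB: "A \<subseteq> {0..<D}" "B \<subseteq> {0..<D}" for j A B
  proof -
    define pre where "pre = (\<lambda>S. {a \<in> {0..<D}. pos a \<in> S})"
    have pre: "card (pre S) = card S" if "S \<subseteq> {0..<D}" for S
    proof -
      have "card (pre S) = card {a \<in> {0..<D}. a \<in> S}"
        unfolding pre_def by (rule card_filter_bij[OF pos, symmetric])
      also have "{a \<in> {0..<D}. a \<in> S} = S" using that by auto
      finally show ?thesis .
    qed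
    have pre_Int: "pre A \<inter> pre B = pre (A \<inter> B)" by (auto simp: pre_def)
    have dens: "pair_density (j \<le> t) D (pre A) (pre B) = pair_density (j \<le> t) D A B"
      using AB by (simp add: pair_density_def pre_Int pre le_infI1)
    have mem: "pos (lam c) \<in> S \<longleftrightarrow> lam c \<in> pre S" for c S
      using lam by (simp add: pre_def)
    let ?w = "poly (v j) (int n)"
    have "card {q \<in> {0..<D * r}. q div r \<in> A \<and> cyc (D * r) pos' ?w q div r \<in> B}
       = card {c \<in> {0..<D * r}. pos' c div r \<in> A \<and> cyc (D * r) pos' ?w (pos' c) div r \<in> B}"
      by (rule card_filter_bij[OF pos'])
    also have "{c \<in> {0..<D * r}. pos' c div r \<in> A \<and> cyc (D * r) pos' ?w (pos' c) div r \<in> B}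
       = {c \<in> {0..<D * r}. lam c \<in> pre A \<and> lam ((c + ?w) mod (D * r)) \<in> pre B}"
      by (intro Collect_cong conj_cong refl) (simp_all only: cyc' lift mem)
    finally have eq: "card {q \<in> {0..<D * r}. q div r \<in> A \<and> cyc (D * r) pos' ?w q div r \<in> B}
       = card {c \<in> {0..<D * r}. lam c \<in> pre A \<and> lam ((c + ?w) mod (D * r)) \<in> pre B}" .
    have "pre A \<subseteq> {0..<D}" "pre B \<subseteq> {0..<D}" by (auto simp: pre_def)
    from pairs[rule_format, OF j this]
    have "\<bar>card {q \<in> {0..<D * r}. q div r \<in> A \<and> cyc (D * r) pos' ?w q div r \<in> B}
        - D * r * pair_density (j \<le> t) D (pre A) (pre B)\<bar> \<le> \<epsilon> * (D * r)"
      unfolding eq .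
    then show ?thesis unfolding dens .
  qed
  show ?thesis
    by (rule that[of n r pos', OF n r pos' succ']) (intro ballI allI impI, rule pairs')
qed

section \<open>Cells of the unit interval\<close>

lemma prob_space_unit_lborel: "prob_space unit_lborel"
  by (rule prob_spaceI) (simp add: emeasure_restrict_space space_restrict_space)

lemma space_unit_lborel [simp]: "space unit_lborel = {0..1}"
  by (simp add: space_restrict_space)

lemma borel_measurable_unit_lborel: "f \<in> borel_measurable borel \<Longrightarrow> f \<in> borel_measurable unit_lborel"
  by (simp add: measurable_restrict_space1)

text \<open>
The index of the interval of length \<open>1 / D\<close> that contains the point. The end point 1 has the
index \<open>D\<close>, outside the range \<open>{0..<D}\<close>; statements about cells hold almost everywhere.
\<close>

definition cell :: "int \<Rightarrow> real \<Rightarrow> int" where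
  "cell D x = \<lfloor>of_int D * x\<rfloor>"

lemma cell_range: "D > 0 \<Longrightarrow> 0 \<le> x \<Longrightarrow> x < 1 \<Longrightarrow> cell D x \<in> {0..<D}"
  by (auto simp: cell_def floor_less_iff)

lemma cell_refine: "r > 0 \<Longrightarrow> cell (D * r) x div r = cell D x"
proof -
  assume r: "r > 0"
  have "cell (D * r) x div r = \<lfloor>of_int (D * r) * x / of_int r\<rfloor>"
    unfolding cell_def by (rule floor_divide_real_eq_div[symmetric]) (use r in simp)
  also have "of_int (D * r) * x / of_int r = of_int D * x" using r by simp
  finally show ?thesis by (simp add: cell_def)
qed

lemma measurable_cell [measurable]: "cell D \<in> measurable unit_lborel (count_space UNIV)"
proof -
  have "(\<lambda>x::real. \<lfloor>of_int D * x\<rfloor>) \<in> measurable borel (count_space UNIV)"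
    by (rule measurable_compose[OF _ measurable_real_floor]) simp
  then show ?thesis unfolding cell_def by (intro measurable_restrict_space1) simp
qed

lemma sets_cell_pred: "{x \<in> {0..1}. \<phi> (cell D x)} \<in> sets unit_lborel"
proof -
  have "cell D -` Collect \<phi> \<inter> space unit_lborel \<in> sets unit_lborel"
    by (rule measurable_sets[OF measurable_cell]) simp
  also have "cell D -` Collect \<phi> \<inter> space unit_lborel = {x \<in> {0..1}. \<phi> (cell D x)}" by auto
  finally show ?thesis .
qed

lemma AE_cell_range: "D > 0 \<Longrightarrow> AE x in unit_lborel. cell D x \<in> {0..<D}"
proof -
  assume D: "D > 0"
  have "AE x in lborel. x \<in> {0..1} \<longrightarrow> cell D x \<in> {0..<D}"
    using AE_lborel_singleton[of "1::real"] by eventually_elim (use cell_range[OF D] in \<open>auto simp del: atLeastLessThan_iff\<close>)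
  then show ?thesis by (subst AE_restrict_space_iff) auto
qed

lemma measure_cell_eq:
  assumes "D > 0" "c \<in> {0..<D}"
  shows "measure unit_lborel {x \<in> {0..1}. cell D x = c} = 1 / D"
proof -
  define S where "S = {of_int c / of_int D ..< (of_int c + 1) / of_int D :: real}"
  have le: "(of_int c + 1) / of_int D \<le> (1::real)" "0 \<le> of_int c / (of_int D :: real)"
    using assms by (auto simp: field_simps)
  have "{x \<in> {0..1}. cell D x = c} = S"
  proof (intro equalityI subsetI)
    fix x assume x: "x \<in> S"
    then have "0 \<le> x" "x \<le> 1" using le unfolding S_def by auto
    then show "x \<in> {x \<in> {0..1}. cell D x = c}"
      using x assms unfolding S_def by (auto simp: cell_def floor_eq_iff field_simps)
  qed (use assms in \<open>auto simp: S_def cell_def floor_eq_iff field_simps\<close>)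
  moreover have "measure unit_lborel S = measure lborel S"
    using le by (subst measure_restrict_space) (auto simp: S_def)
  moreover have "measure lborel S = 1 / D"
    using assms by (simp add: S_def divide_right_mono add_divide_distrib)
  ultimately show ?thesis by simp
qed

lemma measure_cell_pred:
  assumes "D > 0"
  shows "measure unit_lborel {x \<in> {0..1}. \<phi> (cell D x)} = card {c \<in> {0..<D}. \<phi> c} / D"
proof -
  interpret prob_space unit_lborel by (rule prob_space_unit_lborel)
  have "measure unit_lborel {x \<in> {0..1}. \<phi> (cell D x)}
      = measure unit_lborel (\<Union>c\<in>{c \<in> {0..<D}. \<phi> c}. {x \<in> {0..1}. cell D x = c})"
    using AE_cell_range[OF assms] 
    by (intro finite_measure_eq_AE sets.finite_UN sets_cell_pred finite_subset[OF Collect_restrict]) auto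
  also have "\<dots> = (\<Sum>c\<in>{c \<in> {0..<D}. \<phi> c}. measure unit_lborel {x \<in> {0..1}. cell D x = c})"
    by (intro finite_measure_finite_Union finite_subset[OF Collect_restrict])
       (auto simp: disjoint_family_on_def intro: sets_cell_pred simp del: atLeastAtMost_iff)
  also have "\<dots> = (\<Sum>c\<in>{c \<in> {0..<D}. \<phi> c}. 1 / D)"
    using assms by (intro sum.cong refl measure_cell_eq) auto
  finally show ?thesis by simp
qed

section \<open>The limit of nearly compatible cell permutations\<close>

text \<open>
Permutations \<open>\<pi> i\<close> of ever finer cells, where \<open>\<pi> (Suc i)\<close> induces \<open>\<pi> i\<close> on the coarser
cells outside a set of measure \<open>\<epsilon> i\<close>. Since the errors are summable, almost every point meets only
finitely many of them.
\<close>

locale cell_maps =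
  fixes D r :: "nat \<Rightarrow> int" and \<pi> :: "nat \<Rightarrow> int \<Rightarrow> int" and \<epsilon> :: "nat \<Rightarrow> real"
  assumes D0: "D 0 > 0" and r: "\<And>i. r i \<ge> 2" and D_Suc: "\<And>i. D (Suc i) = D i * r i"
    and bij: "\<And>i. bij_betw (\<pi> i) {0..<D i} {0..<D i}"
    and summable: "summable \<epsilon>"
    and close: "\<And>i. card {q \<in> {0..<D (Suc i)}. \<pi> (Suc i) q div r i \<noteq> \<pi> i (q div r i)} \<le> \<epsilon> i * D (Suc i)"
begin

sublocale prob_space unit_lborel
  by (rule prob_space_unit_lborel)

lemma D_pos: "D i > 0"
proof (induction i)
  case (Suc i)
  then show ?case using r[of i] by (simp add: D_Suc)
qed (rule D0)

lemma D_ge: "real_of_int (D i) \<ge> 2 ^ i"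
proof (induction i)
  case 0
  then show ?case using D0 by simp
next
  case (Suc i)
  have "2 ^ i * 2 \<le> real_of_int (D i) * real_of_int (r i)"
    using Suc r[of i] D_pos[of i] by (intro mult_mono) auto
  then show ?case by (simp add: D_Suc)
qed

lemma inverse_D_tendsto: "(\<lambda>i. 1 / real_of_int (D i)) \<longlonglongrightarrow> 0"
proof (rule Lim_null_comparison)
  show "\<forall>\<^sub>F i in sequentially. norm (1 / real_of_int (D i)) \<le> (1 / 2) ^ i"
  proof (intro always_eventually allI)
    fix i
    have "1 / real_of_int (D i) \<le> 1 / 2 ^ i" using D_ge[of i] by (intro frac_le) auto
    then show "norm (1 / real_of_int (D i)) \<le> (1 / 2) ^ i"
      using D_pos[of i] by (simp add: power_one_over)
  qed
qed (intro LIMSEQ_realpow_zero; simp)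

definition bad :: "nat \<Rightarrow> real set" where
  "bad i = {x \<in> {0..1}. \<pi> (Suc i) (cell (D (Suc i)) x) div r i \<noteq> \<pi> i (cell (D i) x)}"

lemma bad_eq: "bad i = {x \<in> {0..1}. \<pi> (Suc i) (cell (D (Suc i)) x) div r i \<noteq> \<pi> i (cell (D (Suc i)) x div r i)}"
proof -
  have "cell (D (Suc i)) x div r i = cell (D i) x" for x
    unfolding D_Suc using r[of i] by (intro cell_refine) auto
  then show ?thesis by (simp add: bad_def)
qed

lemma bad_sets [measurable]: "bad i \<in> sets unit_lborel"
  unfolding bad_eq by (rule sets_cell_pred)

lemma measure_bad: "prob (bad i) \<le> \<epsilon> i"
  unfolding bad_eq measure_cell_pred[OF D_pos, where \<phi> = "\<lambda>q. \<pi> (Suc i) q div r i \<noteq> \<pi> i (q div r i)"]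
  using close[of i] D_pos[of "Suc i"]
  by (simp add: pos_divide_le_eq del: atLeastLessThan_iff)

lemma summable_bad: "summable (\<lambda>i. prob (bad i))"
  by (rule summable_comparison_test'[OF summable, of 0]) (simp add: measure_bad)

text \<open>
The left end point of the cell to which \<open>\<pi> i\<close> sends the cell of \<open>x\<close>.
\<close>

definition corner :: "nat \<Rightarrow> real \<Rightarrow> real" where
  "corner i x = of_int (\<pi> i (cell (D i) x)) / of_int (D i)"

lemma measurable_corner [measurable]: "corner i \<in> borel_measurable unit_lborel"
proof -
  have "(\<lambda>q. of_int (\<pi> i q) / of_int (D i) :: real) \<in> measurable (count_space UNIV) borel" by simp
  from measurable_compose[OF measurable_cell this] show ?thesis unfolding corner_def .
qed

text \<open>
The truncation to \<open>{0..1}\<close> only matters on the null set where the limit does not exist.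
\<close>

definition limit :: "real \<Rightarrow> real" where
  "limit x = max 0 (min 1 (lim (\<lambda>i. corner i x)))"

lemma borel_limit [measurable]: "limit \<in> borel_measurable unit_lborel"
  unfolding limit_def by measurable

lemma measurable_limit: "limit \<in> measurable unit_lborel unit_lborel"
  by (rule measurable_restrict_space2) (auto simp: limit_def)

text \<open>
From level \<open>k\<close> on, the image cells of \<open>x\<close> are nested, so their end points converge and the
limit lies in all the closed cells.
\<close>

lemma limit_enclosed:
  assumes good: "\<And>i. i \<ge> k \<Longrightarrow> x \<notin> bad i" and x: "0 \<le> x" "x < 1"
  shows "(\<lambda>i. corner i x) \<longlonglongrightarrow> limit x"
    and "i \<ge> k \<Longrightarrow> corner i x \<le> limit x \<and> limit x \<le> corner i x + 1 / D i"
proof -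
  define q where "q = (\<lambda>i. \<pi> i (cell (D i) x))"
  have q: "q i \<in> {0..<D i}" for i
    unfolding q_def using cell_range[OF D_pos x] bij by (meson bij_betwE)
  have nest: "q (Suc i) div r i = q i" if "i \<ge> k" for i
    using good[OF that] x by (auto simp: bad_def q_def)
  have c: "corner i x = q i / D i" for i by (simp add: corner_def q_def)
  have step: "corner i x \<le> corner (Suc i) x \<and> corner (Suc i) x + 1 / D (Suc i) \<le> corner i x + 1 / D i"
    if "i \<ge> k" for i
  proof -
    have r0: "r i > 0" using r[of i] by simp
    \<comment> \<open>The image cell of level \<open>Suc i\<close> is one of the \<open>r i\<close> pieces of the image cell of level \<open>i\<close>.\<close>
    have "q i * r i \<le> q (Suc i)" "q (Suc i) + 1 \<le> (q i + 1) * r i"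
      using nest[OF that] r0 div_mult_mod_eq[of "q (Suc i)" "r i"] pos_mod_bound[OF r0, of "q (Suc i)"]
        pos_mod_sign[OF r0, of "q (Suc i)"] by (auto simp: algebra_simps)
    then have "of_int (q i * r i) \<le> (of_int (q (Suc i)) :: real)"
      "of_int (q (Suc i) + 1) \<le> (of_int ((q i + 1) * r i) :: real)"
      by (simp_all only: of_int_le_iff)
    moreover have "0 \<le> real_of_int (D i * r i)" using D_pos[of i] r0 by simp
    ultimately have "of_int (q i * r i) / of_int (D i * r i) \<le> (of_int (q (Suc i)) / of_int (D i * r i) :: real)"
      "of_int (q (Suc i) + 1) / of_int (D i * r i) \<le> (of_int ((q i + 1) * r i) / of_int (D i * r i) :: real)"
      by (simp_all only: divide_right_mono)
    then show ?thesis using r0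
      unfolding c D_Suc add_divide_distrib[symmetric] by simp
  qed
  have "\<exists>l. ((\<forall>n. corner (n + k) x \<le> l) \<and> (\<lambda>n. corner (n + k) x) \<longlonglongrightarrow> l) \<and>
      ((\<forall>n. l \<le> corner (n + k) x + 1 / D (n + k)) \<and> (\<lambda>n. corner (n + k) x + 1 / D (n + k)) \<longlonglongrightarrow> l)"
  proof (rule nested_sequence_unique)
    show "(\<lambda>n. corner (n + k) x - (corner (n + k) x + 1 / D (n + k))) \<longlonglongrightarrow> 0"
      using tendsto_minus[OF LIMSEQ_ignore_initial_segment[OF inverse_D_tendsto, of k]] by simp
    show "\<forall>n. corner (n + k) x \<le> corner (Suc n + k) x"
      "\<forall>n. corner (Suc n + k) x + 1 / D (Suc n + k) \<le> corner (n + k) x + 1 / D (n + k)"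
      using step[of "_ + k"] by simp_all
    show "\<forall>n. corner (n + k) x \<le> corner (n + k) x + 1 / D (n + k)"
      using D_pos[THEN less_imp_le] by simp
  qed
  then obtain l where l: "\<And>n. corner (n + k) x \<le> l" "\<And>n. l \<le> corner (n + k) x + 1 / D (n + k)"
    and lim: "(\<lambda>n. corner (n + k) x) \<longlonglongrightarrow> l" by blast
  have lim: "(\<lambda>i. corner i x) \<longlonglongrightarrow> l" using lim by (rule LIMSEQ_offset)
  have "corner i x \<in> {0..1}" for i
    using q[of i] D_pos[of i] by (simp add: c)
  then have "l \<in> {0..1}" by (intro closed_sequentially[OF closed_atLeastAtMost _ lim])
  then have eq: "limit x = l" by (simp add: limit_def limI[OF lim])
  show "(\<lambda>i. corner i x) \<longlonglongrightarrow> limit x" unfolding eq by (rule lim)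
  show "corner i x \<le> limit x \<and> limit x \<le> corner i x + 1 / D i" if "i \<ge> k"
    using l[of "i - k"] that by (simp add: eq)
qed

lemma AE_interior: "AE x in unit_lborel. 0 \<le> x \<and> x < 1"
proof -
  have "AE x in lborel. x \<in> {0..1} \<longrightarrow> 0 \<le> x \<and> x < (1::real)"
    using AE_lborel_singleton[of "1::real"] by eventually_elim auto
  then show ?thesis by (subst AE_restrict_space_iff) auto
qed

lemma AE_eventually_good: "AE x in unit_lborel. \<exists>k. \<forall>i\<ge>k. x \<notin> bad i"
proof -
  have "AE x in unit_lborel. eventually (\<lambda>i. x \<in> space unit_lborel - bad i) sequentially"
    by (intro borel_cantelli_AE1 bad_sets summable_bad) (simp add: emeasure_eq_measure)
  then show ?thesis by eventually_elim (auto simp: eventually_sequentially)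
qed

text \<open>
A permutation of cells of equal measure preserves the distribution of the cell index.
\<close>

lemma integral_permuted:
  fixes f :: "int \<Rightarrow> complex"
  shows "(CLINT x|unit_lborel. f (\<pi> i (cell (D i) x))) = (CLINT x|unit_lborel. f (cell (D i) x))"
proof -
  let ?C = "count_space UNIV :: int measure"
  have m: "(\<lambda>x. \<pi> i (cell (D i) x)) \<in> measurable unit_lborel ?C"
    by (rule measurable_compose[OF measurable_cell]) simp
  have "distr unit_lborel ?C (\<lambda>x. \<pi> i (cell (D i) x)) = distr unit_lborel ?C (cell (D i))"
  proof (rule measure_eqI)
    fix S assume "S \<in> sets (distr unit_lborel ?C (\<lambda>x. \<pi> i (cell (D i) x)))"
    have 1: "(\<lambda>x. \<pi> i (cell (D i) x)) -` S \<inter> space unit_lborel = {x \<in> {0..1}. \<pi> i (cell (D i) x) \<in> S}"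
      and 2: "cell (D i) -` S \<inter> space unit_lborel = {x \<in> {0..1}. cell (D i) x \<in> S}" by auto
    have "card {c \<in> {0..<D i}. \<pi> i c \<in> S} = card {c \<in> {0..<D i}. c \<in> S}"
      by (rule card_filter_bij[OF bij, symmetric])
    then have "prob {x \<in> {0..1}. \<pi> i (cell (D i) x) \<in> S} = prob {x \<in> {0..1}. cell (D i) x \<in> S}"
      unfolding measure_cell_pred[OF D_pos, where \<phi> = "\<lambda>q. \<pi> i q \<in> S"]
        measure_cell_pred[OF D_pos, where \<phi> = "\<lambda>q. q \<in> S"] by simp
    then show "emeasure (distr unit_lborel ?C (\<lambda>x. \<pi> i (cell (D i) x))) S
        = emeasure (distr unit_lborel ?C (cell (D i))) S"
      using m by (simp add: emeasure_distr emeasure_eq_measure 1[simplified] 2[simplified])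
  qed simp
  moreover have "integral\<^sup>L (distr unit_lborel ?C (\<lambda>x. \<pi> i (cell (D i) x))) f
      = (CLINT x|unit_lborel. f (\<pi> i (cell (D i) x)))"
    by (rule integral_distr[OF m]) simp
  moreover have "integral\<^sup>L (distr unit_lborel ?C (cell (D i))) f = (CLINT x|unit_lborel. f (cell (D i) x))"
    by (rule integral_distr[OF measurable_cell]) simp
  ultimately show ?thesis by (simp only:)
qed

lemma AE_corner_tendsto: "AE x in unit_lborel. (\<lambda>i. corner i x) \<longlonglongrightarrow> limit x"
  using AE_eventually_good AE_interior
proof eventually_elim
  case (elim x)
  then obtain k where "\<forall>i\<ge>k. x \<notin> bad i" by blast
  with elim(2) show ?case by (intro limit_enclosed(1)[of k x]) auto
qed

lemma cell_tendsto: "(\<lambda>i. cell (D i) x / D i) \<longlonglongrightarrow> x"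
proof -
  have "(\<lambda>i. cell (D i) x / D i - x) \<longlonglongrightarrow> 0"
  proof (rule Lim_null_comparison[OF _ inverse_D_tendsto])
    have "norm (cell (D i) x / D i - x) \<le> 1 / D i" for i
    proof -
      have "cell (D i) x / D i - x = (of_int (cell (D i) x) - of_int (D i) * x) / D i"
        using D_pos[of i] by (simp add: field_simps)
      moreover have "\<bar>of_int (cell (D i) x) - of_int (D i) * x\<bar> \<le> 1"
        unfolding cell_def by linarith
      ultimately show ?thesis using D_pos[of i] by (simp add: abs_divide divide_right_mono)
    qed
    then show "\<forall>\<^sub>F i in sequentially. norm (cell (D i) x / D i - x) \<le> 1 / D i" by simp
  qed
  then show ?thesis by (simp add: LIM_zero_iff)
qed

text \<open>
The corners \<open>corner i x\<close> and the rounded points \<open>cell (D i) x / D i\<close> have the same distribution;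
the first converge to \<open>limit x\<close> and the second to \<open>x\<close>. By dominated convergence \<open>limit\<close> and the
identity have the same characteristic function, hence the same law.
\<close>

lemma distr_limit_borel: "distr unit_lborel borel limit = distr unit_lborel borel (\<lambda>x. x)"
proof (rule Levy_uniqueness)
  have id: "(\<lambda>x. x) \<in> borel_measurable unit_lborel" by (intro borel_measurable_unit_lborel) simp
  show "real_distribution (distr unit_lborel borel limit)"
       "real_distribution (distr unit_lborel borel (\<lambda>x. x))"
    using id by (auto intro!: real_distribution_distr)
  show "char (distr unit_lborel borel limit) = char (distr unit_lborel borel (\<lambda>x. x))"
  proof
    fix t
    let ?e = "\<lambda>y. iexp (t * y)"
    have [measurable]: "(\<lambda>x. of_int (cell (D i) x) / of_int (D i) :: real) \<in> borel_measurable unit_lborel" for i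
      by (rule measurable_compose[OF measurable_cell]) simp
    have lim1: "(\<lambda>i. CLINT x|unit_lborel. ?e (corner i x)) \<longlonglongrightarrow> (CLINT x|unit_lborel. ?e (limit x))"
    proof (rule integral_dominated_convergence[where w = "\<lambda>_. 1"])
      show "AE x in unit_lborel. (\<lambda>i. ?e (corner i x)) \<longlonglongrightarrow> ?e (limit x)"
        using AE_corner_tendsto by eventually_elim (intro tendsto_intros)
    qed (auto simp: norm_exp_i_times)
    have lim2: "(\<lambda>i. CLINT x|unit_lborel. ?e (cell (D i) x / D i)) \<longlonglongrightarrow> (CLINT x|unit_lborel. ?e x)"
    proof (rule integral_dominated_convergence[where w = "\<lambda>_. 1"])
      show "AE x in unit_lborel. (\<lambda>i. ?e (cell (D i) x / D i)) \<longlonglongrightarrow> ?e x"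
        by (intro AE_I2 tendsto_intros cell_tendsto)
    qed (use id in \<open>auto simp: norm_exp_i_times\<close>)
    have eq: "(CLINT x|unit_lborel. ?e (corner i x)) = (CLINT x|unit_lborel. ?e (cell (D i) x / D i))" for i
      unfolding corner_def by (rule integral_permuted[of "\<lambda>q. ?e (q / D i)" i])
    have "(CLINT x|unit_lborel. ?e (limit x)) = (CLINT x|unit_lborel. ?e x)"
      by (rule LIMSEQ_unique[OF lim1[unfolded eq] lim2])
    then show "char (distr unit_lborel borel limit) t = char (distr unit_lborel borel (\<lambda>x. x)) t"
      using id unfolding char_def by (simp add: integral_distr)
  qed
qed

lemma distr_limit: "distr unit_lborel unit_lborel limit = unit_lborel"
proof (rule measure_eqI)
  fix A assume "A \<in> sets (distr unit_lborel unit_lborel limit)"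
  then have A: "A \<in> sets unit_lborel" by simp
  then have A': "A \<in> sets borel" "A \<subseteq> {0..1}" by (auto simp: sets_restrict_space_iff)
  have id: "(\<lambda>x. x) \<in> borel_measurable unit_lborel" by (intro borel_measurable_unit_lborel) simp
  have "emeasure (distr unit_lborel unit_lborel limit) A = emeasure (distr unit_lborel borel limit) A"
    using A A' measurable_limit by (simp add: emeasure_distr)
  also have "\<dots> = emeasure unit_lborel (A \<inter> {0..1})"
    unfolding distr_limit_borel using A' id by (simp add: emeasure_distr)
  also have "A \<inter> {0..1} = A" using A' by auto
  finally show "emeasure (distr unit_lborel unit_lborel limit) A = emeasure unit_lborel A" .
qed simp

text \<open>
The limit is only known to lie in closed cells. Because its law is Lebesgue measure, it almost
never hits one of the countably many end points, so the closed cell determines its cell.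
\<close>

lemma AE_limit_not_grid: "AE x in unit_lborel. \<forall>i. of_int (D i) * limit x \<notin> \<int>"
proof -
  let ?grid = "\<Union>i. (\<lambda>n. of_int n / of_int (D i) :: real) ` UNIV"
  have "AE y in lborel. y \<notin> ?grid"
    by (intro AE_not_in countable_imp_null_set_lborel countable_UN countable_image) auto
  then have "AE y in lborel. y \<in> {0..1} \<longrightarrow> y \<notin> ?grid" by eventually_elim blast
  then have "AE y in unit_lborel. y \<notin> ?grid" by (subst AE_restrict_space_iff) auto
  then have "AE y in unit_lborel. \<forall>i. of_int (D i) * y \<notin> \<int>"
  proof eventually_elim
    case (elim y)
    show ?case
    proof (intro allI notI)
      fix i assume "of_int (D i) * y \<in> \<int>"
      then obtain n where "of_int (D i) * y = of_int n" by (auto elim: Ints_cases)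
      then have "y = of_int n / of_int (D i)" using D_pos[of i] by (simp add: field_simps)
      then show False using elim by blast
    qed
  qed
  then have "AE y in distr unit_lborel unit_lborel limit. \<forall>i. of_int (D i) * y \<notin> \<int>"
    by (simp only: distr_limit)
  from AE_distrD[OF measurable_limit this] show ?thesis .
qed

lemma AE_cell_limit:
  "AE x in unit_lborel. \<forall>k. (\<forall>i\<ge>k. x \<notin> bad i) \<longrightarrow> (\<forall>i\<ge>k. cell (D i) (limit x) = \<pi> i (cell (D i) x))"
  using AE_limit_not_grid AE_interior
proof eventually_elim
  case (elim x)
  show ?case
  proof (intro allI impI)
    fix k i assume k: "\<forall>i\<ge>k. x \<notin> bad i" "i \<ge> k"
    let ?q = "\<pi> i (cell (D i) x)"
    have "corner i x \<le> limit x" "limit x \<le> corner i x + 1 / D i"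
      using limit_enclosed(2)[of k x i] k elim by auto
    then have "?q \<le> D i * limit x" "D i * limit x \<le> ?q + 1"
      using D_pos[of i] by (auto simp: corner_def field_simps)
    moreover have "D i * limit x \<noteq> ?q + 1"
      using elim(1) by (metis Ints_1 Ints_add Ints_of_int)
    ultimately have "\<lfloor>D i * limit x\<rfloor> = ?q" by (simp add: floor_eq_iff)
    then show "cell (D i) (limit x) = ?q" by (simp add: cell_def)
  qed
qed

lemma AE_eventually_cell_limit:
  "AE x in unit_lborel. \<exists>k. \<forall>i\<ge>k. cell (D i) (limit x) = \<pi> i (cell (D i) x)"
  using AE_eventually_good AE_cell_limit by eventually_elim blast

lemma measure_cell_limit:
  "prob {x \<in> {0..1}. cell (D i) (limit x) \<noteq> \<pi> i (cell (D i) x)} \<le> (\<Sum>l. \<epsilon> (l + i))"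
proof -
  have s: "summable (\<lambda>l. prob (bad (l + i)))"
    using summable_ignore_initial_segment[OF summable_bad] .
  have "prob {x \<in> {0..1}. cell (D i) (limit x) \<noteq> \<pi> i (cell (D i) x)} \<le> prob (\<Union>l. bad (l + i))"
  proof (rule finite_measure_mono_AE)
    show "AE x in unit_lborel. x \<in> {x \<in> {0..1}. cell (D i) (limit x) \<noteq> \<pi> i (cell (D i) x)} \<longrightarrow> x \<in> (\<Union>l. bad (l + i))"
      using AE_cell_limit
    proof eventually_elim
      case (elim x)
      show ?case
      proof (rule impI, rule ccontr)
        assume x: "x \<in> {x \<in> {0..1}. cell (D i) (limit x) \<noteq> \<pi> i (cell (D i) x)}" "x \<notin> (\<Union>l. bad (l + i))"
        have "x \<notin> bad l" if "l \<ge> i" for l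
        proof -
          have "x \<notin> bad ((l - i) + i)" using x(2) by blast
          then show ?thesis using that by simp
        qed
        then have "cell (D i) (limit x) = \<pi> i (cell (D i) x)" using elim by blast
        with x(1) show False by simp
      qed
    qed
  qed (intro sets.countable_UN image_subsetI bad_sets)
  also have "\<dots> \<le> (\<Sum>l. prob (bad (l + i)))"
    by (intro finite_measure_subadditive_countably image_subsetI bad_sets s)
  also have "\<dots> \<le> (\<Sum>l. \<epsilon> (l + i))"
    using s summable_ignore_initial_segment[OF summable] by (intro suminf_le measure_bad)
  finally show ?thesis .
qed

end

section \<open>From almost everywhere inverse maps to automorphisms\<close>

lemma AE_funpow:
  assumes "T \<in> measurable M M" "distr M M T = M" "AE x in M. P x"
  shows "AE x in M. P ((T ^^ n) x)"
proof (induction n)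
  case (Suc n)
  then have "AE x in distr M M T. P ((T ^^ n) x)" by (simp only: assms(2))
  from AE_distrD[OF assms(1) this] show ?case by (simp add: funpow_swap1)
qed (use assms in simp)

lemma distr_funpow:
  assumes "T \<in> measurable M M" "distr M M T = M"
  shows "distr M M (T ^^ n) = M"
proof (induction n)
  case 0
  show ?case by (simp add: id_def distr_id)
next
  case (Suc n)
  have "distr M M (T ^^ Suc n) = distr (distr M M (T ^^ n)) M T"
    unfolding funpow.simps(2)
    by (rule distr_distr[OF assms(1) measurable_compose_n[OF assms(1)], symmetric])
  then show ?case by (simp only: Suc assms(2))
qed

text \<open>
Restrict \<open>T\<close> to the set \<open>V\<close> of points whose forward orbits under \<open>T\<close> and under \<open>S\<close> stay in the good
set; this set is invariant under both maps and has full measure. Off \<open>V\<close> the identity is used.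
\<close>

lemma automorphism_of_AE_inverse:
  assumes T: "T \<in> measurable M M" "distr M M T = M" and S: "S \<in> measurable M M" "distr M M S = M"
    and ST: "AE x in M. S (T x) = x" and TS: "AE x in M. T (S x) = x"
  obtains T' where "T' \<in> Aut M" "AE x in M. T' x = T x" "AE x in M. inv_into (space M) T' x = S x"
proof -
  have "AE x in M. S (T x) = x \<and> T (S x) = x" using ST TS by eventually_elim simp
  then obtain N where N: "N \<in> null_sets M" "{x \<in> space M. \<not> (S (T x) = x \<and> T (S x) = x)} \<subseteq> N"
    unfolding eventually_ae_filter by blast
  define G where "G = space M - N"
  have G: "G \<in> sets M" "AE x in M. x \<in> G"
    using N(1) AE_not_in[OF N(1)] AE_space[of M] by (auto simp: G_def)
  have G_inv: "S (T x) = x" "T (S x) = x" if "x \<in> G" for x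
    using N(2) that by (auto simp: G_def)
  define V where "V = {x \<in> space M. \<forall>n. (T ^^ n) x \<in> G \<and> (S ^^ n) x \<in> G}"
  have "{x \<in> space M. (T ^^ n) x \<in> G} \<in> sets M" "{x \<in> space M. (S ^^ n) x \<in> G} \<in> sets M" for n
    using measurable_sets[OF measurable_compose_n[OF T(1)] G(1), of n]
      measurable_sets[OF measurable_compose_n[OF S(1)] G(1), of n]
    by (auto simp: vimage_def Int_def conj_commute)
  then have V: "V \<in> sets M" unfolding V_def
    by (intro sets.sets_Collect_countable_All sets.sets_Collect_conj)
  have "AE x in M. \<forall>n. (T ^^ n) x \<in> G \<and> (S ^^ n) x \<in> G"
    using AE_funpow[OF T G(2)] AE_funpow[OF S G(2)] by (simp add: AE_all_countable)
  with AE_space have AE_V: "AE x in M. x \<in> V" by eventually_elim (simp add: V_def)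
  have VG: "x \<in> G" "x \<in> space M" if "x \<in> V" for x
    using that by (auto simp: V_def dest: spec[of _ 0])
  have TV: "T x \<in> V" if x: "x \<in> V" for x
  proof -
    have "(T ^^ n) (T x) \<in> G \<and> (S ^^ n) (T x) \<in> G" for n
    proof -
      have "(T ^^ n) (T x) = (T ^^ Suc n) x" by (simp add: funpow_swap1)
      \<comment> \<open>One step back cancels one step forward, so only the orbit of \<open>x\<close> itself is involved.\<close>
      moreover have "(S ^^ n) (T x) = (case n of 0 \<Rightarrow> (T ^^ 1) x | Suc k \<Rightarrow> (S ^^ k) x)"
        using G_inv(1)[OF VG(1)[OF x]] by (cases n) (simp_all add: funpow_swap1[symmetric] funpow_Suc_right del: funpow.simps(2))
      ultimately show ?thesis using x unfolding V_def by (auto split: nat.split simp del: funpow.simps(2))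
    qed
    then show ?thesis using VG(2)[OF x] T(1) unfolding V_def by (auto simp: measurable_space)
  qed
  have SV: "S x \<in> V" if x: "x \<in> V" for x
  proof -
    have "(S ^^ n) (S x) \<in> G \<and> (T ^^ n) (S x) \<in> G" for n
    proof -
      have "(S ^^ n) (S x) = (S ^^ Suc n) x" by (simp add: funpow_swap1)
      moreover have "(T ^^ n) (S x) = (case n of 0 \<Rightarrow> (S ^^ 1) x | Suc k \<Rightarrow> (T ^^ k) x)"
        using G_inv(2)[OF VG(1)[OF x]] by (cases n) (simp_all add: funpow_swap1[symmetric] funpow_Suc_right del: funpow.simps(2))
      ultimately show ?thesis using x unfolding V_def by (auto split: nat.split simp del: funpow.simps(2))
    qed
    then show ?thesis using VG(2)[OF x] S(1) unfolding V_def by (auto simp: measurable_space)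
  qed
  define T' where "T' = (\<lambda>x. if x \<in> V then T x else x)"
  define S' where "S' = (\<lambda>x. if x \<in> V then S x else x)"
  have meas: "T' \<in> measurable M M" "S' \<in> measurable M M"
    unfolding T'_def S'_def using T(1) S(1) V by (auto intro!: measurable_If_set)
  have inv: "S' (T' x) = x" "T' (S' x) = x" for x
    using TV SV G_inv VG by (auto simp: T'_def S'_def)
  have bij: "bij_betw T' (space M) (space M)"
    by (rule bij_betw_byWitness[where f' = S']) (use inv meas in \<open>auto simp: measurable_space\<close>)
  have inv_into: "inv_into (space M) T' x = S' x" if "x \<in> space M" for x
    using bij inv that meas by (intro inv_into_f_eq) (auto simp: bij_betw_def measurable_space)
  have AE_T: "AE x in M. T' x = T x" using AE_V by eventually_elim (simp add: T'_def)
  have "AE x in M. inv_into (space M) T' x = S x"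
    using AE_V AE_space by eventually_elim (simp add: inv_into S'_def)
  moreover have "distr M M T' = distr M M T"
    using AE_T T(1) meas by (intro distr_cong_AE) auto
  then have "T' \<in> Aut M"
    unfolding Aut_def using bij meas T(2) measurable_cong[of M "inv_into (space M) T'" S', OF inv_into] by simp
  ultimately show ?thesis using AE_T that by blast
qed

lemma sets_neq_countable:
  fixes f g :: "'a \<Rightarrow> 'b :: countable"
  assumes "f \<in> measurable M (count_space UNIV)" "g \<in> measurable M (count_space UNIV)"
  shows "{x \<in> space M. f x \<noteq> g x} \<in> sets M"
proof -
  have "{x \<in> space M. f x \<noteq> g x} = space M - (\<Union>c. (f -` {c} \<inter> space M) \<inter> (g -` {c} \<inter> space M))" by auto
  also have "\<dots> \<in> sets M"
    using assms by (intro sets.compl_sets sets.countable_UN' sets.Int measurable_sets) auto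
  finally show ?thesis .
qed

text \<open>
If \<open>h\<close> follows \<open>\<pi>\<close> on cells up to measure \<open>\<delta>\<close>, then, since \<open>h\<close> preserves the measure, each of \<open>m\<close>
steps goes wrong on a set of measure at most \<open>\<delta>\<close>.
\<close>

lemma measure_cell_funpow:
  assumes h: "h \<in> measurable unit_lborel unit_lborel" "distr unit_lborel unit_lborel h = unit_lborel"
    and \<delta>: "measure unit_lborel {x \<in> {0..1}. cell D (h x) \<noteq> \<pi> (cell D x)} \<le> \<delta>"
  shows "measure unit_lborel {x \<in> {0..1}. cell D ((h ^^ m) x) \<noteq> (\<pi> ^^ m) (cell D x)} \<le> m * \<delta>"
proof -
  interpret prob_space unit_lborel by (rule prob_space_unit_lborel)
  have hm: "(h ^^ m) \<in> measurable unit_lborel unit_lborel" for m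
    by (rule measurable_compose_n[OF h(1)])
  have sets: "{x \<in> {0..1}. cell D ((h ^^ m) x) \<noteq> \<sigma> (cell D x)} \<in> sets unit_lborel" for m \<sigma>
  proof -
    have "(\<lambda>x. \<sigma> (cell D x)) \<in> measurable unit_lborel (count_space UNIV)"
      by (rule measurable_compose[OF measurable_cell]) simp
    from sets_neq_countable[OF measurable_compose[OF hm measurable_cell] this] show ?thesis by simp
  qed
  let ?E = "{x \<in> {0..1}. cell D (h x) \<noteq> \<pi> (cell D x)}"
  show ?thesis
  proof (induction m)
    case 0
    show ?case by simp
  next
    case (Suc m)
    let ?F = "{x \<in> {0..1}. cell D ((h ^^ m) x) \<noteq> (\<pi> ^^ m) (cell D x)}"
    have E: "?E \<in> sets unit_lborel" using sets[of 1 \<pi>] by simp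
    have "{x \<in> {0..1}. cell D ((h ^^ Suc m) x) \<noteq> (\<pi> ^^ Suc m) (cell D x)}
        \<subseteq> ((h ^^ m) -` ?E \<inter> space unit_lborel) \<union> ?F"
    proof
      fix x assume x: "x \<in> {x \<in> {0..1}. cell D ((h ^^ Suc m) x) \<noteq> (\<pi> ^^ Suc m) (cell D x)}"
      then have "(h ^^ m) x \<in> {0..1}" using measurable_space[OF hm[of m], of x] by simp
      with x show "x \<in> ((h ^^ m) -` ?E \<inter> space unit_lborel) \<union> ?F"
        by (cases "cell D ((h ^^ m) x) = (\<pi> ^^ m) (cell D x)") simp_all
    qed
    then have "prob {x \<in> {0..1}. cell D ((h ^^ Suc m) x) \<noteq> (\<pi> ^^ Suc m) (cell D x)}
        \<le> prob ((h ^^ m) -` ?E \<inter> space unit_lborel) + prob ?F"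
      using measurable_sets[OF hm E] sets
      by (intro order_trans[OF finite_measure_mono measure_Un_le]) auto
    also have "prob ((h ^^ m) -` ?E \<inter> space unit_lborel) = measure (distr unit_lborel unit_lborel (h ^^ m)) ?E"
      using hm E by (simp add: measure_distr)
    also have "\<dots> = prob ?E" by (simp add: distr_funpow[OF h])
    finally show ?case using \<delta> Suc.IH by (simp add: algebra_simps)
  qed
qed

lemma cyc_in: "bij_betw pos {0..<D} {0..<D} \<Longrightarrow> D > 0 \<Longrightarrow> cyc D pos m q \<in> {0..<D}"
  unfolding cyc_def by (rule bij_betwE[THEN bspec]) auto

lemma cyc_add:
  assumes "bij_betw pos {0..<D} {0..<D}" "D > 0"
  shows "cyc D pos m (cyc D pos l q) = cyc D pos (l + m) q"
  using assms unfolding cyc_def by (simp add: bij_betw_inv_into_left mod_simps algebra_simps)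

lemma cyc_0:
  assumes "bij_betw pos {0..<D} {0..<D}" "q \<in> {0..<D}"
  shows "cyc D pos 0 q = q"
proof -
  have "inv_into {0..<D} pos q \<in> {0..<D}"
    using bij_betwE[OF bij_betw_inv_into[OF assms(1)]] assms(2) by blast
  then show ?thesis using assms unfolding cyc_def by (simp add: bij_betw_inv_into_right)
qed

lemma cyc_funpow:
  assumes "bij_betw pos {0..<D} {0..<D}" "D > 0" "q \<in> {0..<D}"
  shows "(cyc D pos k ^^ m) q = cyc D pos (k * int m) q"
proof (induction m)
  case 0
  then show ?case using assms by (simp add: cyc_0)
next
  case (Suc m)
  then show ?case using assms by (simp add: cyc_add algebra_simps)
qed

lemma bij_betw_cyc:
  assumes "bij_betw pos {0..<D} {0..<D}" "D > 0"
  shows "bij_betw (cyc D pos m) {0..<D} {0..<D}"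
  by (rule bij_betw_byWitness[where f' = "cyc D pos (- m)"])
     (use cyc_in[OF assms] in \<open>auto simp: cyc_add assms cyc_0 simp del: atLeastLessThan_iff\<close>)

text \<open>
The substitution \<open>q = cyc (D * r) pos' 1 p\<close> turns an error of the inverse permutation into an error of
the permutation itself, so both directions converge at the same rate.
\<close>

lemma card_cyc_backward:
  assumes pos: "bij_betw pos {0..<D} {0..<D}" "D > 0" and r: "r > 0"
    and pos': "bij_betw pos' {0..<D * r} {0..<D * r}"
  shows "card {q \<in> {0..<D * r}. cyc (D * r) pos' (-1) q div r \<noteq> cyc D pos (-1) (q div r)}
       = card {q \<in> {0..<D * r}. cyc (D * r) pos' 1 q div r \<noteq> cyc D pos 1 (q div r)}"
proof -
  have Dr: "D * r > 0" using pos r by simp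
  have "card {q \<in> {0..<D * r}. cyc (D * r) pos' (-1) q div r \<noteq> cyc D pos (-1) (q div r)}
     = card {q \<in> {0..<D * r}. cyc (D * r) pos' (-1) (cyc (D * r) pos' 1 q) div r
          \<noteq> cyc D pos (-1) (cyc (D * r) pos' 1 q div r)}"
    by (rule card_filter_bij[OF bij_betw_cyc[OF pos' Dr]])
  also have "{q \<in> {0..<D * r}. cyc (D * r) pos' (-1) (cyc (D * r) pos' 1 q) div r
          \<noteq> cyc D pos (-1) (cyc (D * r) pos' 1 q div r)}
     = {q \<in> {0..<D * r}. cyc (D * r) pos' 1 q div r \<noteq> cyc D pos 1 (q div r)}"
  proof (intro Collect_cong conj_cong refl)
    fix q assume q: "q \<in> {0..<D * r}"
    let ?a = "q div r" and ?b = "cyc (D * r) pos' 1 q div r"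
    have ab: "?a \<in> {0..<D}" "?b \<in> {0..<D}"
      using div_in_range[OF r q] div_in_range[OF r cyc_in[OF pos' Dr]] by auto
    have "cyc (D * r) pos' (-1) (cyc (D * r) pos' 1 q) = q"
      using cyc_add[OF pos' Dr] cyc_0[OF pos' q] by simp
    moreover have "cyc D pos 1 (cyc D pos (-1) ?b) = ?b" "cyc D pos (-1) (cyc D pos 1 ?a) = ?a"
      using cyc_add[OF pos] cyc_0[OF pos(1)] ab by simp_all
    then have "?a = cyc D pos (-1) ?b \<longleftrightarrow> ?b = cyc D pos 1 ?a" by auto
    ultimately show "cyc (D * r) pos' (-1) (cyc (D * r) pos' 1 q) div r \<noteq> cyc D pos (-1) ?b
        \<longleftrightarrow> ?b \<noteq> cyc D pos 1 ?a" by simp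
  qed
  finally show ?thesis .
qed

text \<open>
Both limits follow the permutations on all sufficiently fine cells, so the composition moves almost
every point within cells of vanishing length.
\<close>

lemma AE_inverse_limits:
  assumes "cell_maps D r \<pi> \<epsilon>" "cell_maps D r \<rho> \<epsilon>"
    and inv: "\<And>i q. q \<in> {0..<D i} \<Longrightarrow> \<rho> i (\<pi> i q) = q"
  shows "AE x in unit_lborel. cell_maps.limit D \<rho> (cell_maps.limit D \<pi> x) = x"
proof -
  interpret F: cell_maps D r \<pi> \<epsilon> by fact
  interpret B: cell_maps D r \<rho> \<epsilon> by fact
  have "AE y in distr unit_lborel unit_lborel F.limit. \<exists>k. \<forall>i\<ge>k. cell (D i) (B.limit y) = \<rho> i (cell (D i) y)"
    unfolding F.distr_limit by (rule B.AE_eventually_cell_limit)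
  from AE_distrD[OF F.measurable_limit this] F.AE_eventually_cell_limit F.AE_interior
  show ?thesis
  proof eventually_elim
    case (elim x)
    then obtain k l where
      k: "\<And>i. i \<ge> k \<Longrightarrow> cell (D i) (B.limit (F.limit x)) = \<rho> i (cell (D i) (F.limit x))" and
      l: "\<And>i. i \<ge> l \<Longrightarrow> cell (D i) (F.limit x) = \<pi> i (cell (D i) x)" by blast
    have "cell (D i) (B.limit (F.limit x)) = cell (D i) x" if "i \<ge> max k l" for i
      using k[of i] l[of i] inv[of "cell (D i) x" i] cell_range[OF F.D_pos[of i], of x] elim(3) that by simp
    then have "eventually (\<lambda>i. cell (D i) (B.limit (F.limit x)) / D i = cell (D i) x / D i) sequentially"
      by (intro eventually_sequentiallyI[of "max k l"]) simp
    from Lim_transform_eventually[OF F.cell_tendsto this] show ?case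
      using LIMSEQ_unique F.cell_tendsto by blast
  qed
qed

text \<open>
Images under negative powers become preimages, for which measurability and measures are known.
\<close>

lemma int_iterate_vimage:
  assumes T: "bij_betw T S S" and B: "B \<subseteq> S"
  shows "int_iterate S T (- m) ` B = {x \<in> S. int_iterate S T m x \<in> B}"
proof -
  let ?I = "inv_into S T"
  have I: "bij_betw ?I S S" by (rule bij_betw_inv_into[OF T])
  have TI: "T (?I x) = x" "?I (T x) = x" if "x \<in> S" for x
    using T that by (simp_all add: bij_betw_inv_into_right bij_betw_inv_into_left)
  have in_S: "(T ^^ n) x \<in> S" "(?I ^^ n) x \<in> S" if "x \<in> S" for x n
    using that bij_betwE[OF T] bij_betwE[OF I] by (induction n) auto
  have inv: "(T ^^ n) ((?I ^^ n) x) = x \<and> (?I ^^ n) ((T ^^ n) x) = x" if "x \<in> S" for x n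
    using that
  proof (induction n)
    case (Suc n)
    have "(T ^^ Suc n) ((?I ^^ Suc n) x) = (T ^^ n) (T (?I ((?I ^^ n) x)))"
      by (simp add: funpow_swap1)
    moreover have "(?I ^^ Suc n) ((T ^^ Suc n) x) = (?I ^^ n) (?I (T ((T ^^ n) x)))"
      by (simp add: funpow_swap1)
    ultimately show ?case using Suc TI in_S by simp
  qed simp
  have image: "f ` B = {x \<in> S. g x \<in> B}" if fg: "\<And>x. x \<in> S \<Longrightarrow> f x \<in> S \<and> g (f x) = x \<and> f (g x) = x" for f g :: "'a \<Rightarrow> 'a"
  proof (intro equalityI subsetI)
    fix x assume "x \<in> {x \<in> S. g x \<in> B}"
    then have "x = f (g x)" "g x \<in> B" using fg[of x] by simp_all
    then show "x \<in> f ` B" by (rule image_eqI)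
  next
    fix x assume "x \<in> f ` B"
    then obtain b where b: "b \<in> B" "x = f b" by blast
    then have "b \<in> S" using B by blast
    then show "x \<in> {x \<in> S. g x \<in> B}" using b fg[of b] by simp
  qed
  show ?thesis
  proof (cases "m > 0")
    case True
    then have "int_iterate S T (- m) = ?I ^^ nat m" "int_iterate S T m = T ^^ nat m"
      by (simp_all add: int_iterate_def)
    then show ?thesis using in_S inv by (simp add: image)
  next
    case False
    then have "int_iterate S T (- m) = T ^^ nat (- m)" "int_iterate S T m = ?I ^^ nat (- m)"
      by (simp_all add: int_iterate_def)
    then show ?thesis using in_S inv by (simp add: image)
  qed
qed

section \<open>Extending convergence from a generating family\<close>

text \<open>
Domination by a finite measure lets limits pass through countable disjoint unions (by Tannery's theorem),
so the sets on which convergence holds form a Dynkin system.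
\<close>

lemma tendsto_additive_extension:
  fixes \<phi> :: "nat \<Rightarrow> 'a set \<Rightarrow> real" and \<psi> :: "'a set \<Rightarrow> real"
  assumes M: "finite_measure M" and G: "G \<subseteq> Pow \<Omega>" "Int_stable G" "\<Omega> \<in> G" "sets M = sigma_sets \<Omega> G"
    and \<phi>_add: "\<And>k F. disjoint_family F \<Longrightarrow> range F \<subseteq> sets M \<Longrightarrow> (\<lambda>i. \<phi> k (F i)) sums \<phi> k (\<Union>i. F i)"
    and \<psi>_add: "\<And>F. disjoint_family F \<Longrightarrow> range F \<subseteq> sets M \<Longrightarrow> (\<lambda>i. \<psi> (F i)) sums \<psi> (\<Union>i. F i)"
    and bound: "\<And>k A. A \<in> sets M \<Longrightarrow> 0 \<le> \<phi> k A \<and> \<phi> k A \<le> measure M A"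
    and base: "\<And>A. A \<in> G \<Longrightarrow> (\<lambda>k. \<phi> k A) \<longlonglongrightarrow> \<psi> A"
    and A: "A \<in> sets M"
  shows "(\<lambda>k. \<phi> k A) \<longlonglongrightarrow> \<psi> A"
proof -
  interpret finite_measure M by (rule M)
  have add_empty: "f {} = 0" and add_diff: "A \<in> sets M \<Longrightarrow> f (\<Omega> - A) = f \<Omega> - f A"
    if f: "\<And>F. disjoint_family F \<Longrightarrow> range F \<subseteq> sets M \<Longrightarrow> (\<lambda>i. f (F i)) sums f (\<Union>i. F i)"
    for f :: "'a set \<Rightarrow> real" and A
  proof -
    have "(\<lambda>i::nat. f {}) sums f (\<Union>i::nat. {})"
      by (rule f) (auto simp: disjoint_family_on_def)
    then have "summable (\<lambda>i::nat. f {})" by (rule sums_summable)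
    then show e: "f {} = 0" by (simp add: summable_const_iff)
    assume A: "A \<in> sets M"
    have sub: "A \<subseteq> \<Omega>" using A G by (metis sigma_sets_into_sp)
    have "\<Omega> - A \<in> sets M" using A unfolding G(4) by (rule sigma_sets.Compl)
    then have "(\<lambda>i. f (binaryset A (\<Omega> - A) i)) sums f (\<Union>i. binaryset A (\<Omega> - A) i)"
      using A by (intro f) (auto simp: disjoint_family_on_def binaryset_def)
    moreover have "(\<lambda>i. f (binaryset A (\<Omega> - A) i)) sums (f A + f (\<Omega> - A))"
      using sums_finite[of "{0, 1::nat}" "\<lambda>i. f (binaryset A (\<Omega> - A) i)"] e by (auto simp: binaryset_def)
    ultimately have "f (\<Union>i. binaryset A (\<Omega> - A) i) = f A + f (\<Omega> - A)" by (rule sums_unique2)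
    then show "f (\<Omega> - A) = f \<Omega> - f A" using sub by (simp add: UN_binaryset_eq Un_absorb1)
  qed
  have A': "A \<in> sigma_sets \<Omega> G" using A G(4) by simp
  show ?thesis
    using G(2,1) A'
  proof (induction rule: sigma_sets_induct_disjoint)
    case (basic A)
    then show ?case by (rule base)
  next
    case empty
    have "\<phi> k {} = 0" for k by (rule add_empty[of "\<phi> k", OF \<phi>_add])
    moreover have "\<psi> {} = 0" by (rule add_empty[of \<psi>, OF \<psi>_add])
    ultimately show ?case by simp
  next
    case (compl A)
    then have A: "A \<in> sets M" using G(4) by simp
    have "\<phi> k (\<Omega> - A) = \<phi> k \<Omega> - \<phi> k A" for k by (rule add_diff[OF \<phi>_add A])
    moreover have "\<psi> (\<Omega> - A) = \<psi> \<Omega> - \<psi> A" by (rule add_diff[OF \<psi>_add A])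
    ultimately show ?case using tendsto_diff[OF base[OF G(3)] compl(2)] by simp
  next
    case (union F)
    have F: "disjoint_family F" "range F \<subseteq> sets M" using union G(4) by auto
    have "(\<lambda>k. \<Sum>i. \<phi> k (F i)) \<longlonglongrightarrow> (\<Sum>i. \<psi> (F i))"
    proof (rule tannerys_theorem[THEN conjunct2, THEN conjunct2, of "\<lambda>i k. \<phi> k (F i)"])
      show "(\<lambda>k. \<phi> k (F i)) \<longlonglongrightarrow> \<psi> (F i)" for i using union by blast
      show "\<forall>\<^sub>F (i, k) in sequentially \<times>\<^sub>F sequentially. norm (\<phi> k (F i)) \<le> measure M (F i)"
        using bound F by (intro always_eventually) auto
      show "summable (\<lambda>i. measure M (F i))"
        using finite_measure_UNION[OF F(2,1)] by (rule sums_summable)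
    qed simp
    then show ?case
      using sums_unique[OF \<phi>_add[OF F]] sums_unique[OF \<psi>_add[OF F]] by simp
  qed
qed

context cell_maps
begin

definition cell_sets :: "real set set" where
  "cell_sets = {{x \<in> {0..1}. P (cell (D i) x)} |i P. True}"

lemma cell_at_finer_level:
  assumes "i \<le> k" shows "\<exists>R>0. \<forall>x. cell (D i) x = cell (D k) x div R"
  using assms
proof (induction k rule: dec_induct)
  case base
  show ?case by (intro exI[of _ 1]) simp
next
  case (step k)
  then obtain R where R0: "R > 0" and R: "\<And>x. cell (D i) x = cell (D k) x div R" by blast
  have "cell (D i) x = cell (D (Suc k)) x div (r k * R)" for x
    using r[of k] R0 cell_refine[of "r k" "D k" x] by (simp add: R D_Suc zdiv_zmult2_eq)
  moreover have "r k * R > 0" using r[of k] R0 by simp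
  ultimately show ?case by blast
qed

lemma cell_sets_finer_level:
  assumes "i \<le> k" shows "\<exists>Q. {x \<in> {0..1}. P (cell (D i) x)} = {x \<in> {0..1}. Q (cell (D k) x)}"
proof -
  obtain R where "\<And>x. cell (D i) x = cell (D k) x div R" using cell_at_finer_level[OF assms] by blast
  then show ?thesis by (intro exI[of _ "\<lambda>c. P (c div R)"]) simp
qed

lemma Int_stable_cell_sets: "Int_stable cell_sets"
proof (rule Int_stableI)
  fix A B assume "A \<in> cell_sets" "B \<in> cell_sets"
  then obtain i P j Q where AB: "A = {x \<in> {0..1}. P (cell (D i) x)}" "B = {x \<in> {0..1}. Q (cell (D j) x)}"
    by (auto simp: cell_sets_def)
  obtain P' Q' where "A = {x \<in> {0..1}. P' (cell (D (max i j)) x)}" "B = {x \<in> {0..1}. Q' (cell (D (max i j)) x)}"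
    using cell_sets_finer_level[of i "max i j" P] cell_sets_finer_level[of j "max i j" Q] AB by auto
  then have "A \<inter> B = {x \<in> {0..1}. P' (cell (D (max i j)) x) \<and> Q' (cell (D (max i j)) x)}" by auto
  then show "A \<inter> B \<in> cell_sets"
    unfolding cell_sets_def by (intro CollectI exI[of _ "max i j"] exI[of _ "\<lambda>c. P' c \<and> Q' c"]) simp
qed

text \<open>
The identity is the pointwise limit of the functions \<open>cell (D i) x / D i\<close>, hence measurable for the
sigma-algebra generated by the cells.
\<close>

lemma sets_generated_by_cells: "sets unit_lborel = sigma_sets {0..1} cell_sets"
proof
  have "cell_sets \<subseteq> sets unit_lborel" by (auto simp: cell_sets_def sets_cell_pred simp del: atLeastAtMost_iff)
  then show "sigma_sets {0..1} cell_sets \<subseteq> sets unit_lborel"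
    using sets.sigma_sets_subset[of cell_sets unit_lborel] by simp
  let ?S = "sigma {0..1} cell_sets"
  have sub: "cell_sets \<subseteq> Pow {0..1}" by (auto simp: cell_sets_def)
  have "cell (D i) \<in> measurable ?S (count_space UNIV)" for i
  proof (rule measurableI)
    fix S
    have "cell (D i) -` S \<inter> space ?S = {x \<in> {0..1}. cell (D i) x \<in> S}"
      using sub by (auto simp: space_measure_of)
    also have "\<dots> \<in> cell_sets" unfolding cell_sets_def by blast
    finally show "cell (D i) -` S \<inter> space ?S \<in> sets ?S" using sub by (simp add: sets_measure_of)
  qed simp
  then have "(\<lambda>x. real_of_int (cell (D i) x) / real_of_int (D i)) \<in> borel_measurable ?S" for i
    by (rule measurable_compose) simp
  then have id: "(\<lambda>x. x) \<in> borel_measurable ?S"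
    by (rule borel_measurable_LIMSEQ_real[rotated]) (rule cell_tendsto)
  show "sets unit_lborel \<subseteq> sigma_sets {0..1} cell_sets"
  proof
    fix A assume "A \<in> sets unit_lborel"
    then have A: "A \<in> sets borel" "A \<subseteq> {0..1}" by (auto simp: sets_restrict_space_iff)
    have "(\<lambda>x. x) -` A \<inter> space ?S \<in> sets ?S" by (rule measurable_sets[OF id A(1)])
    moreover have "(\<lambda>x. x) -` A \<inter> space ?S = A" using A(2) sub by (auto simp: space_measure_of)
    ultimately show "A \<in> sigma_sets {0..1} cell_sets" using sub by (simp add: sets_measure_of)
  qed
qed

end

section \<open>The tower of cyclic permutations\<close>

text \<open>
A bound, monotone in \<open>n\<close>, for all the exponents used up to time \<open>n\<close>. The disagreement between later
levels is made small compared with it, so that later levels do not destroy what happens at earlier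
times.
\<close>

definition growth :: "nat \<Rightarrow> (nat \<Rightarrow> int poly) \<Rightarrow> nat \<Rightarrow> real" where
  "growth N v n = 1 + (\<Sum>m\<le>n. \<Sum>j\<in>{1..N}. \<bar>real_of_int (poly (v j) (int m))\<bar>)"

lemma growth_ge_1: "growth N v n \<ge> 1"
  by (simp add: growth_def sum_nonneg)

lemma growth_mono: "m \<le> n \<Longrightarrow> growth N v m \<le> growth N v n"
  unfolding growth_def by (intro add_left_mono sum_mono2) (auto intro: sum_nonneg)

lemma abs_poly_le_growth: "j \<in> {1..N} \<Longrightarrow> \<bar>real_of_int (poly (v j) (int n))\<bar> \<le> growth N v n"
proof -
  assume j: "j \<in> {1..N}"
  let ?f = "\<lambda>m. \<Sum>j\<in>{1..N}. \<bar>real_of_int (poly (v j) (int m))\<bar>"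
  have "\<bar>real_of_int (poly (v j) (int n))\<bar> \<le> ?f n"
    by (rule member_le_sum[OF j]) auto
  also have "\<dots> \<le> (\<Sum>m\<le>n. ?f m)" by (rule member_le_sum) (auto intro: sum_nonneg)
  finally show ?thesis by (simp add: growth_def)
qed

text \<open>
The outcome of one refinement step with precision \<open>\<epsilon>\<close> and time \<open>n\<close>: the finer permutation nearly
induces the coarser one, and its powers \<open>poly (v j) n\<close> already move coarse cells as prescribed.
\<close>

definition refines ::
  "nat \<Rightarrow> (nat \<Rightarrow> int poly) \<Rightarrow> nat \<Rightarrow> real \<Rightarrow> nat \<Rightarrow> int \<Rightarrow> (int \<Rightarrow> int) \<Rightarrow> int \<Rightarrow> (int \<Rightarrow> int) \<Rightarrow> bool" where
  "refines N v t \<epsilon> n D pos r pos' \<longleftrightarrow>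
    r \<ge> 2 \<and> bij_betw pos' {0..<D * r} {0..<D * r} \<and>
    real (card {q \<in> {0..<D * r}. cyc (D * r) pos' 1 q div r \<noteq> cyc D pos 1 (q div r)})
      \<le> \<epsilon> * real_of_int (D * r) \<and>
    (\<forall>j\<in>{1..N}. \<forall>A\<subseteq>{0..<D}. \<forall>B\<subseteq>{0..<D}.
      \<bar>real (card {q \<in> {0..<D * r}. q div r \<in> A \<and> cyc (D * r) pos' (poly (v j) (int n)) q div r \<in> B})
        - real_of_int (D * r) * pair_density (j \<le> t) D A B\<bar> \<le> \<epsilon> * real_of_int (D * r))"

lemma tower_exists:
  assumes indep: "rat_lin_indep {1..N} (\<lambda>j. v j - [:poly (v j) 0:])"
  obtains D r :: "nat \<Rightarrow> int" and pos :: "nat \<Rightarrow> int \<Rightarrow> int" and n :: "nat \<Rightarrow> nat"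
  where "D 0 > 0" "bij_betw (pos 0) {0..<D 0} {0..<D 0}" "\<forall>i. D (Suc i) = D i * r i" "strict_mono n"
    "\<forall>i. refines N v t ((1/2) ^ i / growth N v (n i)) (n (Suc i)) (D i) (pos i) (r i) (pos (Suc i))"
proof -
  define P :: "nat \<Rightarrow> int \<times> (int \<Rightarrow> int) \<times> nat \<Rightarrow> bool" where
    "P = (\<lambda>i (D, pos, n). D > 0 \<and> bij_betw pos {0..<D} {0..<D})"
  \<comment> \<open>The ratio \<open>r\<close> of consecutive levels is recovered as the quotient \<open>D' div D\<close>.\<close>
  define Q :: "nat \<Rightarrow> int \<times> (int \<Rightarrow> int) \<times> nat \<Rightarrow> int \<times> (int \<Rightarrow> int) \<times> nat \<Rightarrow> bool" where
    "Q = (\<lambda>i (D, pos, n) (D', pos', n'). n < n' \<and>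
       D' = D * (D' div D) \<and> refines N v t ((1/2) ^ i / growth N v n) n' D pos (D' div D) pos')"
  have "\<exists>f. \<forall>i. P i (f i) \<and> Q i (f i) (f (Suc i))"
  proof (rule dependent_nat_choice)
    show "\<exists>x. P 0 x" by (rule exI[of _ "(1, id, 0)"]) (simp add: P_def)
  next
    fix x i assume x: "P i x"
    obtain D pos n where x_eq: "x = (D, pos, n)" by (cases x)
    have D: "D > 0" and pos: "bij_betw pos {0..<D} {0..<D}" using x by (auto simp: x_eq P_def)
    have eps: "(1/2) ^ i / growth N v n > 0" using growth_ge_1[of N v n] by simp
    obtain n' r pos' where n': "n' > n" and r: "r \<ge> 2" and pos': "bij_betw pos' {0..<D * r} {0..<D * r}"
      and close: "card {q \<in> {0..<D * r}. cyc (D * r) pos' 1 q div r \<noteq> cyc D pos 1 (q div r)}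
        \<le> (1/2) ^ i / growth N v n * (D * r)"
      and pairs: "\<forall>j\<in>{1..N}. \<forall>A\<subseteq>{0..<D}. \<forall>B\<subseteq>{0..<D}.
        \<bar>card {q \<in> {0..<D * r}. q div r \<in> A \<and> cyc (D * r) pos' (poly (v j) (int n')) q div r \<in> B}
          - D * r * pair_density (j \<le> t) D A B\<bar> \<le> (1/2) ^ i / growth N v n * (D * r)"
      by (rule cutting_step[OF indep D eps pos, where K = n and t = t])
    have "refines N v t ((1/2) ^ i / growth N v n) n' D pos r pos'"
      unfolding refines_def using r pos' close pairs by (intro conjI)
    then have "P (Suc i) (D * r, pos', n') \<and> Q i x (D * r, pos', n')"
      using D r pos' n' by (simp add: P_def Q_def x_eq)
    then show "\<exists>y. P (Suc i) y \<and> Q i x y" by blast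
  qed
  then obtain f where P: "\<And>i. P i (f i)" and Q: "\<And>i. Q i (f i) (f (Suc i))" by blast
  define D where "D = (\<lambda>i. fst (f i))"
  define pos where "pos = (\<lambda>i. fst (snd (f i)))"
  define n where "n = (\<lambda>i. snd (snd (f i)))"
  have f: "f i = (D i, pos i, n i)" for i by (simp add: D_def pos_def n_def)
  show ?thesis
  proof (rule that[of D pos "\<lambda>i. D (Suc i) div D i" n])
    show "D 0 > 0" "bij_betw (pos 0) {0..<D 0} {0..<D 0}"
      using P[of 0] by (simp_all add: P_def f)
    show "\<forall>i. D (Suc i) = D i * (D (Suc i) div D i)" using Q by (simp add: Q_def f)
    show "strict_mono n" using Q by (simp add: strict_mono_Suc_iff Q_def f)
    show "\<forall>i. refines N v t ((1/2) ^ i / growth N v (n i)) (n (Suc i)) (D i) (pos i)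
        (D (Suc i) div D i) (pos (Suc i))" using Q by (simp add: Q_def f)
  qed
qed

lemma (in finite_measure) abs_measure_diff_le:
  assumes "X \<in> sets M" "Y \<in> sets M" "E \<in> sets M" "AE x in M. x \<notin> E \<longrightarrow> (x \<in> X \<longleftrightarrow> x \<in> Y)"
  shows "\<bar>measure M X - measure M Y\<bar> \<le> measure M E"
proof -
  have "measure M X \<le> measure M (Y \<union> E)" "measure M Y \<le> measure M (X \<union> E)"
    using assms by (auto intro!: finite_measure_mono_AE)
  moreover have "measure M (Y \<union> E) \<le> measure M Y + measure M E" "measure M (X \<union> E) \<le> measure M X + measure M E"
    using assms by (auto intro!: measure_Un_le)
  ultimately show ?thesis by linarith
qed

lemma (in finite_measure) sums_measure_vimage:
  assumes "h \<in> measurable M M" "X \<in> sets M" "disjoint_family F" "range F \<subseteq> sets M"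
  shows "(\<lambda>i. measure M (X \<inter> (h -` F i \<inter> space M))) sums measure M (X \<inter> (h -` (\<Union>i. F i) \<inter> space M))"
proof -
  have "X \<inter> (h -` (\<Union>i. F i) \<inter> space M) = (\<Union>i. X \<inter> (h -` F i \<inter> space M))" by auto
  moreover have "(\<lambda>i. measure M (X \<inter> (h -` F i \<inter> space M))) sums measure M (\<Union>i. X \<inter> (h -` F i \<inter> space M))"
    using assms by (intro finite_measure_UNION) (auto simp: disjoint_family_on_def intro!: sets.Int measurable_sets[of h M M])
  ultimately show ?thesis by simp
qed

lemma (in finite_measure) sums_measure_Int:
  assumes "X \<in> sets M" "disjoint_family F" "range F \<subseteq> sets M"
  shows "(\<lambda>i. measure M (F i \<inter> X)) sums measure M ((\<Union>i. F i) \<inter> X)"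
  unfolding UN_extend_simps
  using assms by (intro finite_measure_UNION) (auto simp: disjoint_family_on_def)

section \<open>The limit automorphism along the chosen times\<close>

lemma measurable_cell_err:
  assumes "h \<in> measurable unit_lborel unit_lborel"
  shows "{x \<in> {0..1}. cell D (h x) \<noteq> \<sigma> (cell D x)} \<in> sets unit_lborel"
proof -
  have "(\<lambda>x. \<sigma> (cell D x)) \<in> measurable unit_lborel (count_space UNIV)"
    by (rule measurable_compose[OF measurable_cell]) simp
  from sets_neq_countable[OF measurable_compose[OF assms measurable_cell] this] show ?thesis by simp
qed

text \<open>
At step \<open>i\<close> the precision \<open>(1/2) ^ i\<close> is divided by \<open>growth N v (n i)\<close>: the errors of step \<open>i\<close> and later
must remain negligible after the \<open>poly (v j) (n i)\<close> iterations that produced level \<open>i\<close>.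
\<close>

locale cutting_tower =
  fixes N t :: nat and v :: "nat \<Rightarrow> int poly" and D r :: "nat \<Rightarrow> int" and pos :: "nat \<Rightarrow> int \<Rightarrow> int"
    and n :: "nat \<Rightarrow> nat"
  assumes D0: "D 0 > 0" and pos0: "bij_betw (pos 0) {0..<D 0} {0..<D 0}"
    and D_Suc: "\<forall>i. D (Suc i) = D i * r i" and n: "strict_mono n"
    and refine: "\<forall>i. refines N v t ((1/2) ^ i / growth N v (n i)) (n (Suc i)) (D i) (pos i) (r i) (pos (Suc i))"
begin

sublocale prob_space unit_lborel
  by (rule prob_space_unit_lborel)

definition \<epsilon> :: "nat \<Rightarrow> real" where
  "\<epsilon> i = (1/2) ^ i / growth N v (n i)"

lemma r: "r i \<ge> 2"
  using refine by (simp add: refines_def)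

lemma D_pos: "D i > 0"
proof (induction i)
  case (Suc i)
  then show ?case using r[of i] D_Suc by simp
qed (rule D0)

lemma coarse_range: "c \<in> {0..<D (Suc i)} \<Longrightarrow> c div r i \<in> {0..<D i}"
  using div_in_range[of "r i" c "D i"] r[of i] by (simp add: D_Suc del: atLeastLessThan_iff)

lemma pos: "bij_betw (pos i) {0..<D i} {0..<D i}"
  using pos0 refine by (cases i) (simp_all add: refines_def D_Suc)

lemma close: "card {q \<in> {0..<D (Suc i)}. cyc (D (Suc i)) (pos (Suc i)) 1 q div r i
      \<noteq> cyc (D i) (pos i) 1 (q div r i)} \<le> \<epsilon> i * D (Suc i)"
  using refine unfolding refines_def \<epsilon>_def D_Suc[rule_format] by blast

lemma close_back: "card {q \<in> {0..<D (Suc i)}. cyc (D (Suc i)) (pos (Suc i)) (-1) q div r i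
      \<noteq> cyc (D i) (pos i) (-1) (q div r i)} \<le> \<epsilon> i * D (Suc i)"
proof -
  have r0: "r i > 0" using r[of i] by simp
  have p: "bij_betw (pos (Suc i)) {0..<D i * r i} {0..<D i * r i}"
    using pos[of "Suc i"] unfolding D_Suc[rule_format] .
  show ?thesis
    using close[of i] unfolding D_Suc[rule_format] card_cyc_backward[OF pos D_pos r0 p] .
qed

lemma eps_bounds: "0 \<le> \<epsilon> i" "\<epsilon> i \<le> (1/2) ^ i"
  using growth_ge_1[of N v "n i"] by (simp_all add: \<epsilon>_def divide_le_eq mult_le_cancel_left1)

lemma summable_eps: "summable \<epsilon>"
  by (rule summable_comparison_test'[of "\<lambda>i. (1/2) ^ i" 0]) (use eps_bounds in auto)

sublocale Fw: cell_maps D r "\<lambda>i. cyc (D i) (pos i) 1" \<epsilon>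
  by (rule cell_maps.intro)
    (rule D0 r D_Suc[rule_format] bij_betw_cyc[OF pos D_pos] summable_eps close)+

sublocale Bw: cell_maps D r "\<lambda>i. cyc (D i) (pos i) (-1)" \<epsilon>
  by (rule cell_maps.intro)
    (rule D0 r D_Suc[rule_format] bij_betw_cyc[OF pos D_pos] summable_eps close_back)+

text \<open>
The cyclic permutations and their inverses both converge, to maps that are inverse to each other almost
everywhere. The resulting automorphism follows the permutation of level \<open>i\<close> for \<open>\<bar>m\<bar>\<close> steps, in
either direction of time, up to \<open>\<bar>m\<bar>\<close> times the total error of the levels from \<open>i\<close> on.
\<close>

lemma automorphism_exists:
  obtains T where "T \<in> Aut unit_lborel" 
    "\<forall>m. int_iterate {0..1} T m \<in> measurable unit_lborel unit_lborel"
    "\<forall>m. distr unit_lborel unit_lborel (int_iterate {0..1} T m) = unit_lborel"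
    "\<forall>i m. prob {x \<in> {0..1}. cell (D i) (int_iterate {0..1} T m x) \<noteq> cyc (D i) (pos i) m (cell (D i) x)}
        \<le> \<bar>real_of_int m\<bar> * (\<Sum>l. \<epsilon> (l + i))"
proof -
  have "AE x in unit_lborel. Bw.limit (Fw.limit x) = x"
    by (rule AE_inverse_limits[OF Fw.cell_maps_axioms Bw.cell_maps_axioms])
       (simp add: cyc_add[OF pos D_pos] cyc_0[OF pos])
  moreover have "AE x in unit_lborel. Fw.limit (Bw.limit x) = x"
    by (rule AE_inverse_limits[OF Bw.cell_maps_axioms Fw.cell_maps_axioms])
       (simp add: cyc_add[OF pos D_pos] cyc_0[OF pos])
  ultimately obtain T where T: "T \<in> Aut unit_lborel" and T_AE: "AE x in unit_lborel. T x = Fw.limit x"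
    and I_AE: "AE x in unit_lborel. inv_into {0..1} T x = Bw.limit x"
    by (rule automorphism_of_AE_inverse[OF Fw.measurable_limit Fw.distr_limit Bw.measurable_limit Bw.distr_limit,
        unfolded space_unit_lborel])
  let ?I = "inv_into {0..1} T"
  have T_bij: "bij_betw T {0..1} {0..1}" and T_meas: "T \<in> measurable unit_lborel unit_lborel"
    and I_meas: "?I \<in> measurable unit_lborel unit_lborel" and T_distr: "distr unit_lborel unit_lborel T = unit_lborel"
    using T by (simp_all add: Aut_def)
  have I_distr: "distr unit_lborel unit_lborel ?I = unit_lborel"
    using distr_cong_AE[OF refl refl I_AE I_meas Bw.measurable_limit] Bw.distr_limit by simp
  have step_err: "prob {x \<in> {0..1}. cell (D i) (h x) \<noteq> \<sigma> (cell (D i) x)} \<le> d"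
    if h: "AE x in unit_lborel. h x = g x" "g \<in> measurable unit_lborel unit_lborel"
      and g: "prob {x \<in> {0..1}. cell (D i) (g x) \<noteq> \<sigma> (cell (D i) x)} \<le> d" for h g i \<sigma> d
  proof (rule order_trans[OF finite_measure_mono_AE g])
    show "AE x in unit_lborel. x \<in> {x \<in> {0..1}. cell (D i) (h x) \<noteq> \<sigma> (cell (D i) x)}
        \<longrightarrow> x \<in> {x \<in> {0..1}. cell (D i) (g x) \<noteq> \<sigma> (cell (D i) x)}"
      using h(1) by eventually_elim auto
  qed (rule measurable_cell_err[OF h(2)])
  have err: "prob {x \<in> {0..1}. cell (D i) (int_iterate {0..1} T m x) \<noteq> cyc (D i) (pos i) m (cell (D i) x)}
        \<le> \<bar>real_of_int m\<bar> * (\<Sum>l. \<epsilon> (l + i))" for i m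
  proof -
    obtain h k where h: "int_iterate {0..1} T m = h ^^ nat \<bar>m\<bar>" "h \<in> measurable unit_lborel unit_lborel"
        "distr unit_lborel unit_lborel h = unit_lborel"
      and k: "k * int (nat \<bar>m\<bar>) = m"
      and err: "prob {x \<in> {0..1}. cell (D i) (h x) \<noteq> cyc (D i) (pos i) k (cell (D i) x)} \<le> (\<Sum>l. \<epsilon> (l + i))"
    proof (cases "m \<ge> 0")
      case True
      show ?thesis
        by (rule that[of T 1]) (use True T_meas T_distr step_err[OF T_AE Fw.measurable_limit Fw.measure_cell_limit]
          in \<open>auto simp: int_iterate_def\<close>)
    next
      case False
      show ?thesis
        by (rule that[of ?I "-1"]) (use False I_meas I_distr step_err[OF I_AE Bw.measurable_limit Bw.measure_cell_limit]
          in \<open>auto simp: int_iterate_def\<close>)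
    qed
    have "prob {x \<in> {0..1}. cell (D i) (int_iterate {0..1} T m x) \<noteq> cyc (D i) (pos i) m (cell (D i) x)}
        \<le> prob {x \<in> {0..1}. cell (D i) ((h ^^ nat \<bar>m\<bar>) x) \<noteq> (cyc (D i) (pos i) k ^^ nat \<bar>m\<bar>) (cell (D i) x)}"
    proof (rule finite_measure_mono_AE)
      show "AE x in unit_lborel. x \<in> {x \<in> {0..1}. cell (D i) (int_iterate {0..1} T m x) \<noteq> cyc (D i) (pos i) m (cell (D i) x)} \<longrightarrow>
          x \<in> {x \<in> {0..1}. cell (D i) ((h ^^ nat \<bar>m\<bar>) x) \<noteq> (cyc (D i) (pos i) k ^^ nat \<bar>m\<bar>) (cell (D i) x)}"
        using AE_cell_range[OF D_pos[of i]]
      proof eventually_elim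
        case (elim x)
        have "(cyc (D i) (pos i) k ^^ nat \<bar>m\<bar>) (cell (D i) x) = cyc (D i) (pos i) m (cell (D i) x)"
          unfolding cyc_funpow[OF pos D_pos elim] k ..
        then show ?case by (simp add: h(1))
      qed
    qed (rule measurable_cell_err[OF measurable_compose_n[OF h(2)]])
    also have "\<dots> \<le> nat \<bar>m\<bar> * (\<Sum>l. \<epsilon> (l + i))"
      by (rule measure_cell_funpow[OF h(2,3) err])
    finally show ?thesis by simp
  qed
  show ?thesis
  proof (rule that[OF T])
    show "\<forall>m. int_iterate {0..1} T m \<in> measurable unit_lborel unit_lborel"
      using measurable_compose_n[OF T_meas] measurable_compose_n[OF I_meas] by (simp add: int_iterate_def)
    show "\<forall>m. distr unit_lborel unit_lborel (int_iterate {0..1} T m) = unit_lborel"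
      using distr_funpow[OF T_meas T_distr] distr_funpow[OF I_meas I_distr] by (simp add: int_iterate_def)
  qed (use err in blast)
qed

lemma accumulated_error_small:
  assumes j: "j \<in> {1..N}"
  shows "\<bar>real_of_int (poly (v j) (int (n (Suc k))))\<bar> * (\<Sum>l. \<epsilon> (l + Suc k)) \<le> (1/2) ^ k"
proof -
  define \<delta> where "\<delta> = (\<lambda>i. \<Sum>l. \<epsilon> (l + i))"
  let ?g = "growth N v (n (Suc k))"
  have g: "?g \<ge> 1" by (rule growth_ge_1)
  have le: "\<epsilon> (l + Suc k) \<le> (1/2) ^ l * ((1/2) ^ Suc k / ?g)" for l
  proof -
    have "?g \<le> growth N v (n (l + Suc k))"
      using n by (intro growth_mono) (simp add: strict_mono_less_eq)
    then have "\<epsilon> (l + Suc k) \<le> (1/2) ^ (l + Suc k) / ?g"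
      unfolding \<epsilon>_def using g by (intro divide_left_mono) auto
    then show ?thesis by (simp add: power_add)
  qed
  have s: "(\<lambda>l. (1/2) ^ l * ((1/2) ^ Suc k / ?g)) sums (1 / (1 - 1/2) * ((1/2) ^ Suc k / ?g))"
    by (intro sums_mult2 geometric_sums) simp
  have "\<delta> (Suc k) \<le> (\<Sum>l. (1/2) ^ l * ((1/2) ^ Suc k / ?g))"
    unfolding \<delta>_def
    by (intro suminf_le le summable_ignore_initial_segment[OF summable_eps] sums_summable[OF s])
  also have "\<dots> = (1/2) ^ k / ?g" using sums_unique[OF s] by simp
  finally have d: "\<delta> (Suc k) \<le> (1/2) ^ k / ?g" .
  have "0 \<le> \<delta> (Suc k)" unfolding \<delta>_def
    using eps_bounds summable_ignore_initial_segment[OF summable_eps] by (intro suminf_nonneg)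
  then have "\<bar>real_of_int (poly (v j) (int (n (Suc k))))\<bar> * \<delta> (Suc k) \<le> ?g * ((1/2) ^ k / ?g)"
    using d g abs_poly_le_growth[OF j] by (intro mult_mono) auto
  then show ?thesis using g by (simp add: \<delta>_def)
qed

definition target :: "nat \<Rightarrow> real set \<Rightarrow> real set \<Rightarrow> real" where
  "target j A B = (if j \<le> t then prob (A \<inter> B) else prob A * prob B)"

context
  fixes U :: "int \<Rightarrow> real \<Rightarrow> real"
  assumes U_meas: "U m \<in> measurable unit_lborel unit_lborel"
    and U_distr: "distr unit_lborel unit_lborel (U m) = unit_lborel"
    and U_err: "prob {x \<in> {0..1}. cell (D i) (U m x) \<noteq> cyc (D i) (pos i) m (cell (D i) x)} \<le> \<bar>real_of_int m\<bar> * (\<Sum>l. \<epsilon> (l + i))"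
begin

text \<open>
At time \<open>n (Suc k)\<close> the automorphism acts on the cells of level \<open>Suc k\<close> like the permutation of that level,
and this permutation was built to move the cells of level \<open>k\<close> as required. Each of the two
approximations costs at most \<open>(1/2) ^ k\<close>.
\<close>

lemma cells_near_target:
  assumes j: "j \<in> {1..N}" and A: "A = {x \<in> {0..1}. P (cell (D k) x)}" and B: "B = {x \<in> {0..1}. Q (cell (D k) x)}"
  shows "\<bar>prob (A \<inter> (U (poly (v j) (int (n (Suc k)))) -` B \<inter> {0..1})) - target j A B\<bar> \<le> 2 * (1/2) ^ k"
proof -
  define m where "m = poly (v j) (int (n (Suc k)))"
  define Ap where "Ap = {c \<in> {0..<D k}. P c}"
  define Bq where "Bq = {c \<in> {0..<D k}. Q c}"
  let ?D = "D (Suc k)"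
  define \<phi> where "\<phi> = (\<lambda>q. q div r k \<in> Ap \<and> cyc ?D (pos (Suc k)) m q div r k \<in> Bq)"
  have target: "target j A B = pair_density (j \<le> t) (D k) Ap Bq"
  proof -
    have AB: "A \<inter> B = {x \<in> {0..1}. P (cell (D k) x) \<and> Q (cell (D k) x)}" by (auto simp: A B)
    have ApBq: "Ap \<inter> Bq = {c \<in> {0..<D k}. P c \<and> Q c}" by (auto simp: Ap_def Bq_def)
    show ?thesis
      unfolding target_def pair_density_def AB ApBq
      unfolding A B measure_cell_pred[OF D_pos, where \<phi> = "\<lambda>c. P c \<and> Q c"]
        measure_cell_pred[OF D_pos, where \<phi> = P] measure_cell_pred[OF D_pos, where \<phi> = Q] Ap_def Bq_def ..
  qed
  have "\<bar>card {q \<in> {0..<?D}. \<phi> q} - ?D * target j A B\<bar> \<le> \<epsilon> k * ?D"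
  proof -
    have "Ap \<subseteq> {0..<D k}" "Bq \<subseteq> {0..<D k}" by (auto simp: Ap_def Bq_def)
    with refine j show ?thesis
      unfolding target \<phi>_def \<epsilon>_def m_def refines_def D_Suc[rule_format] by blast
  qed
  then have "\<bar>card {q \<in> {0..<?D}. \<phi> q} - ?D * target j A B\<bar> / ?D \<le> \<epsilon> k"
    using D_pos[of "Suc k"] by (simp add: pos_divide_le_eq)
  moreover have "prob {x \<in> {0..1}. \<phi> (cell ?D x)} - target j A B = (card {q \<in> {0..<?D}. \<phi> q} - ?D * target j A B) / ?D"
    unfolding measure_cell_pred[OF D_pos] using D_pos[of "Suc k"] by (simp add: diff_divide_distrib)
  ultimately have "\<bar>prob {x \<in> {0..1}. \<phi> (cell ?D x)} - target j A B\<bar> \<le> \<epsilon> k"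
    using D_pos[of "Suc k"] by (simp add: abs_divide)
  then have 1: "\<bar>prob {x \<in> {0..1}. \<phi> (cell ?D x)} - target j A B\<bar> \<le> (1/2) ^ k"
    using eps_bounds(2)[of k] by simp
  have "\<bar>prob (A \<inter> (U m -` B \<inter> {0..1})) - prob {x \<in> {0..1}. \<phi> (cell ?D x)}\<bar>
      \<le> prob {x \<in> {0..1}. cell ?D (U m x) \<noteq> cyc ?D (pos (Suc k)) m (cell ?D x)}"
  proof (rule abs_measure_diff_le)
    have "A \<in> sets unit_lborel" "B \<in> sets unit_lborel" unfolding A B by (rule sets_cell_pred)+
    then show "A \<inter> (U m -` B \<inter> {0..1}) \<in> sets unit_lborel"
      using measurable_sets[OF U_meas, of B m] by simp
    show "AE x in unit_lborel. x \<notin> {x \<in> {0..1}. cell ?D (U m x) \<noteq> cyc ?D (pos (Suc k)) m (cell ?D x)} \<longrightarrow>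
        (x \<in> A \<inter> (U m -` B \<inter> {0..1}) \<longleftrightarrow> x \<in> {x \<in> {0..1}. \<phi> (cell ?D x)})"
      using AE_cell_range[OF D_pos[of "Suc k"]] AE_space
    proof eventually_elim
      case (elim x)
      have x: "x \<in> {0..1}" using elim by simp
      show ?case
      proof
        assume "x \<notin> {x \<in> {0..1}. cell ?D (U m x) \<noteq> cyc ?D (pos (Suc k)) m (cell ?D x)}"
        with x have same: "cell ?D (U m x) = cyc ?D (pos (Suc k)) m (cell ?D x)" by blast
        have down: "cell (D k) y = cell ?D y div r k" for y
          unfolding D_Suc[rule_format] using r[of k] by (intro cell_refine[symmetric]) simp
        have "cell ?D x div r k \<in> {0..<D k}" by (rule coarse_range[OF elim(1)])
        moreover have "cyc ?D (pos (Suc k)) m (cell ?D x) div r k \<in> {0..<D k}"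
          by (rule coarse_range[OF cyc_in[OF pos D_pos]])
        moreover have "U m x \<in> {0..1}"
          using measurable_space[OF U_meas, of x m] x by simp
        ultimately show "x \<in> A \<inter> (U m -` B \<inter> {0..1}) \<longleftrightarrow> x \<in> {x \<in> {0..1}. \<phi> (cell ?D x)}"
          using x by (simp add: A B \<phi>_def Ap_def Bq_def down same del: atLeastLessThan_iff atLeastAtMost_iff)
      qed
    qed
  qed (rule sets_cell_pred measurable_cell_err[OF U_meas])+
  also have "\<dots> \<le> (1/2) ^ k"
    using U_err[of "Suc k" m] accumulated_error_small[OF j, of k] unfolding m_def by linarith
  finally show ?thesis using 1 unfolding m_def by linarith
qed

lemma cells_tendsto_target:
  assumes j: "j \<in> {1..N}" and AB: "A \<in> Fw.cell_sets" "B \<in> Fw.cell_sets"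
  shows "(\<lambda>k. prob (A \<inter> (U (poly (v j) (int (n (Suc k)))) -` B \<inter> {0..1}))) \<longlonglongrightarrow> target j A B"
proof -
  let ?p = "\<lambda>k. prob (A \<inter> (U (poly (v j) (int (n (Suc k)))) -` B \<inter> {0..1}))"
  obtain a P b Q where A: "A = {x \<in> {0..1}. P (cell (D a) x)}" and B: "B = {x \<in> {0..1}. Q (cell (D b) x)}"
    using AB by (auto simp: Fw.cell_sets_def)
  have "norm (?p k - target j A B) \<le> 2 * (1/2) ^ k" if k: "k \<ge> max a b" for k
  proof -
    have "a \<le> k" "b \<le> k" using k by auto
    then obtain P' Q' where "A = {x \<in> {0..1}. P' (cell (D k) x)}" "B = {x \<in> {0..1}. Q' (cell (D k) x)}"
      using Fw.cell_sets_finer_level[of a k P] Fw.cell_sets_finer_level[of b k Q] unfolding A B by blast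
    from cells_near_target[OF j this] show ?thesis by simp
  qed
  then have "eventually (\<lambda>k. norm (?p k - target j A B) \<le> 2 * (1/2) ^ k) sequentially"
    unfolding eventually_sequentially by blast
  moreover have "(\<lambda>k. 2 * (1/2) ^ k :: real) \<longlonglongrightarrow> 0"
    by (intro tendsto_mult_right_zero LIMSEQ_realpow_zero) auto
  ultimately have "(\<lambda>k. ?p k - target j A B) \<longlonglongrightarrow> 0" by (rule Lim_null_comparison)
  then show ?thesis by (simp add: LIM_zero_iff)
qed

text \<open>
Both sets are generalised in turn: \<open>A\<close> with \<open>B\<close> fixed in the generating family, then \<open>B\<close> with \<open>A\<close>
arbitrary. The bound needed for \<open>B\<close> is the invariance of the measure.
\<close>

lemma tendsto_target:
  assumes j: "j \<in> {1..N}" and AB: "A \<in> sets unit_lborel" "B \<in> sets unit_lborel"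
  shows "(\<lambda>k. prob (A \<inter> (U (poly (v j) (int (n (Suc k)))) -` B \<inter> {0..1}))) \<longlonglongrightarrow> target j A B"
proof -
  have gen: "Fw.cell_sets \<subseteq> Pow {0..1}" "Int_stable Fw.cell_sets" "{0..1} \<in> Fw.cell_sets"
      "sets unit_lborel = sigma_sets {0..1} Fw.cell_sets"
  proof -
    show "Fw.cell_sets \<subseteq> Pow {0..1}" by (auto simp: Fw.cell_sets_def)
    show "{0..1} \<in> Fw.cell_sets"
      unfolding Fw.cell_sets_def by (intro CollectI exI[of _ 0] exI[of _ "\<lambda>_. True"]) auto
  qed (rule Fw.Int_stable_cell_sets Fw.sets_generated_by_cells)+
  have target_add1: "(\<lambda>i. target j (F i) B) sums target j (\<Union>i. F i) B"
    and target_add2: "(\<lambda>i. target j B (F i)) sums target j B (\<Union>i. F i)"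
    if "B \<in> sets unit_lborel" "disjoint_family F" "range F \<subseteq> sets unit_lborel" for j B and F :: "nat \<Rightarrow> real set"
    using sums_measure_Int[OF that] sums_mult[OF finite_measure_UNION[OF that(3,2)], of "prob B"]
    by (auto simp: target_def Int_commute mult.commute)
  let ?w = "\<lambda>k. poly (v j) (int (n (Suc k)))"
  have pre: "U m -` B \<inter> {0..1} \<in> sets unit_lborel" if "B \<in> sets unit_lborel" for m B
    using measurable_sets[OF U_meas that] by simp
  have pre_measure: "prob (U m -` B \<inter> {0..1}) = prob B" if "B \<in> sets unit_lborel" for m B
    using measure_distr[OF U_meas that, of m] by (simp add: U_distr)
  have left: "(\<lambda>k. prob (A \<inter> (U (?w k) -` B \<inter> {0..1}))) \<longlonglongrightarrow> target j A B"
    if B: "B \<in> Fw.cell_sets" and A: "A \<in> sets unit_lborel" for A B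
  proof (rule tendsto_additive_extension[OF finite_measure_axioms gen, where \<psi> = "\<lambda>A. target j A B"])
    have B': "B \<in> sets unit_lborel" using B gen(4) by auto
    show "(\<lambda>i. prob (F i \<inter> (U (?w k) -` B \<inter> {0..1}))) sums prob ((\<Union>i. F i) \<inter> (U (?w k) -` B \<inter> {0..1}))"
      if "disjoint_family F" "range F \<subseteq> sets unit_lborel" for k and F :: "nat \<Rightarrow> real set"
      by (rule sums_measure_Int[OF pre[OF B'] that])
    show "(\<lambda>i. target j (F i) B) sums target j (\<Union>i. F i) B"
      if "disjoint_family F" "range F \<subseteq> sets unit_lborel" for F :: "nat \<Rightarrow> real set"
      by (rule target_add1[OF B' that])
    show "0 \<le> prob (A \<inter> (U (?w k) -` B \<inter> {0..1})) \<and> prob (A \<inter> (U (?w k) -` B \<inter> {0..1})) \<le> prob A"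
      if "A \<in> sets unit_lborel" for k A
      using that by (auto intro: finite_measure_mono)
    show "(\<lambda>k. prob (A \<inter> (U (?w k) -` B \<inter> {0..1}))) \<longlonglongrightarrow> target j A B" if "A \<in> Fw.cell_sets" for A
      by (rule cells_tendsto_target[OF j that B])
  qed (rule A)
  show ?thesis
  proof (rule tendsto_additive_extension[OF finite_measure_axioms gen, where \<psi> = "\<lambda>B. target j A B"])
    show "(\<lambda>i. prob (A \<inter> (U (?w k) -` F i \<inter> {0..1}))) sums prob (A \<inter> (U (?w k) -` (\<Union>i. F i) \<inter> {0..1}))"
      if "disjoint_family F" "range F \<subseteq> sets unit_lborel" for k and F :: "nat \<Rightarrow> real set"
      using sums_measure_vimage[OF U_meas AB(1) that] by simp
    show "(\<lambda>i. target j A (F i)) sums target j A (\<Union>i. F i)"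
      if "disjoint_family F" "range F \<subseteq> sets unit_lborel" for F :: "nat \<Rightarrow> real set"
      by (rule target_add2[OF AB(1) that])
    show "0 \<le> prob (A \<inter> (U (?w k) -` B \<inter> {0..1})) \<and> prob (A \<inter> (U (?w k) -` B \<inter> {0..1})) \<le> prob B"
      if "B \<in> sets unit_lborel" for k B
      using finite_measure_mono[OF _ pre[OF that], of "A \<inter> (U (?w k) -` B \<inter> {0..1})" "?w k"] pre_measure[OF that]
      by auto
    show "(\<lambda>k. prob (A \<inter> (U (?w k) -` B \<inter> {0..1}))) \<longlonglongrightarrow> target j A B" if "B \<in> Fw.cell_sets" for B
      by (rule left[OF that AB(1)])
  qed (rule AB(2))
qed

end

end

theorem corollary1p8:
  fixes N t :: nat and v :: "nat \<Rightarrow> int poly"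
  assumes "N \<ge> 1" and "t \<le> N"
    and "\<And>j. j \<in> {1..N} \<Longrightarrow> degree (v j) > 0"
    and "rat_lin_indep {1..N} (\<lambda>j. v j - [:poly (v j) 0:])"
  shows "\<exists>(n :: nat \<Rightarrow> nat) T.
    strict_mono n \<and> (\<forall>k. n k \<ge> 1) \<and> T \<in> Aut unit_lborel \<and>
    (\<forall>A \<in> sets unit_lborel. \<forall>B \<in> sets unit_lborel. \<forall>j \<in> {1..N}.
      (\<lambda>k. measure unit_lborel
              (A \<inter> int_iterate {0..1} T (- poly (v j) (int (n k))) ` B))
        \<longlonglongrightarrow> (if j \<le> t then measure unit_lborel (A \<inter> B)
            else measure unit_lborel A * measure unit_lborel B))"
proof -
  obtain D r pos n where tower: "D 0 > 0" "bij_betw (pos 0) {0..<D 0} {0..<D 0}"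
    "\<forall>i. D (Suc i) = D i * r i" "strict_mono n"
    "\<forall>i. refines N v t ((1/2) ^ i / growth N v (n i)) (n (Suc i)) (D i) (pos i) (r i) (pos (Suc i))"
    by (rule tower_exists[OF assms(4), where t = t])
  interpret cutting_tower N t v D r pos n
    by (rule cutting_tower.intro) (rule tower)+
  obtain T where T: "T \<in> Aut unit_lborel"
    and U: "\<forall>m. int_iterate {0..1} T m \<in> measurable unit_lborel unit_lborel"
      "\<forall>m. distr unit_lborel unit_lborel (int_iterate {0..1} T m) = unit_lborel"
      "\<forall>i m. prob {x \<in> {0..1}. cell (D i) (int_iterate {0..1} T m x) \<noteq> cyc (D i) (pos i) m (cell (D i) x)}
        \<le> \<bar>real_of_int m\<bar> * (\<Sum>l. \<epsilon> (l + i))"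
    by (rule automorphism_exists)
  have T_bij: "bij_betw T {0..1} {0..1}" using T by (simp add: Aut_def)
  show ?thesis
  proof (intro exI conjI ballI allI)
    show "strict_mono (\<lambda>k. n (Suc k))"
      using n by (simp add: strict_mono_Suc_iff)
    show "n (Suc k) \<ge> 1" for k
      using strict_mono_less[OF n, of 0 "Suc k"] by simp
    show "T \<in> Aut unit_lborel" by (rule T)
    fix A B j assume AB: "A \<in> sets unit_lborel" "B \<in> sets unit_lborel" and j: "j \<in> {1..N}"
    have sub: "B \<subseteq> {0..1}" using sets.sets_into_space[OF AB(2)] by simp
    have "int_iterate {0..1} T (- m) ` B = int_iterate {0..1} T m -` B \<inter> {0..1}" for m
      unfolding int_iterate_vimage[OF T_bij sub] by auto
    then show "(\<lambda>k. prob (A \<inter> int_iterate {0..1} T (- poly (v j) (int (n (Suc k)))) ` B))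
        \<longlonglongrightarrow> (if j \<le> t then prob (A \<inter> B) else prob A * prob B)"
      using tendsto_target[OF U[rule_format] j AB] by (simp only: target_def)
  qed
qed

end
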